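(* Let $n\ge 1$, $0<\xi_1<\dots<\xi_n<1$, $g_i>0$, $g=\sum_{i=1}^n g_i\delta_{\xi_i}$. Let $(a,b)$ be one of the pairs $(0,0),(0,1),(1,2),(2,2)$, and let $d\alpha,d\beta$ be the associated spectral measures, $\langle\cdot|\cdot\rangle$ the associated Cauchy pairing and $\hat f_a,\hat f_b$ the generalized Fourier transforms (all defined in the context). Then Parseval's identity holds: for every $f,h\in L^2_g[0,1]$, $$(f,h)_g=\langle \hat f_a|\hat h_b\rangle=\langle \hat h_a|\hat f_b\rangle .$$
   Context: $L^2_g[0,1]$ is the space of functions on $[0,1]$ with the bilinear inner product $(f,h)_g=\int_0^1 f h\,g\,d\xi=\sum_{i=1}^n g_i f(\xi_i)h(\xi_i)$ (functions are identified if they agree at all $\xi_i$). For $z\in\mathbb{C}$, $\phi(\xi;z)$ is the solution, in the sense of distributions, of $-\phi_{\xi\xi\xi}=z\,g\,\phi$ on $(0,1)$ with $\phi(0)=\phi_\xi(0)=0$, $\phi_{\xi\xi}(0)=1$; that is, $\phi$ is $C^1$, is a quadratic polynomial in $\xi$ between consecutive masses, and $\phi_{\xi\xi}(\xi_i+0)-\phi_{\xi\xi}(\xi_i-0)=-z g_i\phi(\xi_i)$. For $a=0,1,2$, $\phi_a^*(\xi;z)$ is the solution of $\phi^*_{\xi\xi\xi}=z\,g\,\phi^*$ (same sense, with jump $+z g_i\phi^*(\xi_i)$ of $\phi^*_{\xi\xi}$ at $\xi_i$) with the following values at $\xi=1$: for $a=0$, $\phi^*=\phi^*_\xi=0$,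 $\phi^*_{\xi\xi}=1$; for $a=1$, $\phi^*=\phi^*_{\xi\xi}=0$, $\phi^*_\xi=1$; for $a=2$, $\phi^*_\xi=\phi^*_{\xi\xi}=0$, $\phi^*=1$. The spectrum of Type $a$, $\{z_{a,j}\}_{j=1}^n$, is the set of zeros in $z$ of $\phi(1;z)$ for $a=0$, of $\phi_\xi(1;z)$ for $a=1$, of $\phi_{\xi\xi}(1;z)$ for $a=2$ (each of these polynomials in $z$ has exactly $n$ zeros, all simple and positive). The generalized Fourier transform of Type $a$ is $\hat f_a(z)=(-1)^a\int_0^1\phi_a^*(\xi;z)f(\xi)g(\xi)\,d\xi=(-1)^a(\phi_a^*(\cdot;z),f)_g$. The measures for the pair $(a,b)$ are $d\alpha=\sum_{i}A_i\delta_{z_{a,i}}$, $d\beta=\sum_j B_j\delta_{z_{b,j}}$, with (subscript $z$ denoting $\partial/\partial z$): - $(0,0)$: $A_i=\frac{\phi_\xi(1;z_{0,i})}{\phi_z(1;z_{0,i})}$, $B_j=\frac{\phi_\xi(1;z_{0,j})}{\phi_z(1;z_{0,j})}$; - $(0,1)$: $A_i=\frac{\phi_{\xi\xi}(1;z_{0,i})}{\phi_z(1;z_{0,i})}$, $B_j=-\frac{\phi(1;z_{1,j})}{\phi_{\xi z}(1;z_{1,j})}$; - $(1,2)$: $A_i=\frac{\phi_{\xi\xi}(1;z_{1,i})}{\phi_{\xi z}(1;z_{1,i})}$, $B_j=-\frac{\phi(1;z_{2,j})}{\phi_{\xi\xi z}(1;z_{2,j})}$; - $(2,2)$: $A_i=-\frac{\phi_\xi(1;z_{2,i})}{\phi_{\xi\xi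 z}(1;z_{2,i})}$, $B_j=-\frac{\phi_\xi(1;z_{2,j})}{\phi_{\xi\xi z}(1;z_{2,j})}$. The pairing $L^2(\mathbb{R},d\alpha)\times L^2(\mathbb{R},d\beta)\to\mathbb{C}$ is $\langle p|q\rangle=\iint\frac{p(x)q(y)}{x+y}\,d\alpha(x)\,d\beta(y)$. *)

theory Defs
  imports "HOL-Analysis.Analysis"
begin

text \<open>
  A discrete cubic string has \<open>n\<close> masses \<open>g 1, ..., g n\<close> at the points
  \<open>\<xi> 1 < ... < \<xi> n\<close> of the open unit interval. Values of \<open>\<xi>\<close> and \<open>g\<close> at other indices
  are never used.
\<close>

definition cubic_string :: "nat \<Rightarrow> (nat \<Rightarrow> real) \<Rightarrow> (nat \<Rightarrow> real) \<Rightarrow> bool" where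
  "cubic_string n \<xi> g \<longleftrightarrow>
     1 \<le> n \<and> strict_mono_on {1..n} \<xi> \<and> 0 < \<xi> 1 \<and> \<xi> n < 1 \<and> (\<forall>i\<in>{1..n}. 0 < g i)"

text \<open>
  A function on \<open>[0,1]\<close> belongs to \<open>L\<^sup>2\<^sub>g[0,1]\<close> without further condition, since only its
  values at the masses matter. The form is bilinear: there is no complex conjugation.
\<close>

definition inner_g :: "nat \<Rightarrow> (nat \<Rightarrow> real) \<Rightarrow> (nat \<Rightarrow> real) \<Rightarrow>
    (real \<Rightarrow> complex) \<Rightarrow> (real \<Rightarrow> complex) \<Rightarrow> complex" where
  "inner_g n \<xi> g f h = (\<Sum>i=1..n. complex_of_real (g i) * f (\<xi> i) * h (\<xi> i))"

text \<open>The \<open>\<xi>\<close>-derivative on \<open>[0,1]\<close>, one-sided at the two end points.\<close>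

definition D :: "(real \<Rightarrow> complex) \<Rightarrow> real \<Rightarrow> complex" where
  "D u x = vector_derivative u (at x within {0..1})"

text \<open>The end points of the mass-free intervals: \<open>0, \<xi> 1, ..., \<xi> n, 1\<close>.\<close>

definition node :: "nat \<Rightarrow> (nat \<Rightarrow> real) \<Rightarrow> nat \<Rightarrow> real" where
  "node n \<xi> i = (if i = 0 then 0 else if i \<le> n then \<xi> i else 1)"

text \<open>
  Solutions of \<open>u\<^sub>\<xi>\<^sub>\<xi>\<^sub>\<xi> = c g u\<close> on \<open>(0,1)\<close> in the sense of distributions. The condition
  \<open>u \<in> extensional {0..1}\<close> fixes the irrelevant values outside \<open>[0,1]\<close>, so that an initial
  or terminal value problem has a unique solution as a HOL function.
\<close>

definition string_solution :: "nat \<Rightarrow> (nat \<Rightarrow> real) \<Rightarrow> (nat \<Rightarrow> real) \<Rightarrow>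
    complex \<Rightarrow> (real \<Rightarrow> complex) \<Rightarrow> bool" where
  "string_solution n \<xi> g c u \<longleftrightarrow>
     u \<in> extensional {0..1} \<and>
     (\<forall>x\<in>{0..1}. u differentiable (at x within {0..1})) \<and>
     continuous_on {0..1} (D u) \<and>
     (\<forall>i\<le>n. \<exists>p::complex poly. degree p \<le> 2 \<and>
        (\<forall>x\<in>{node n \<xi> i<..<node n \<xi> (Suc i)}. u x = poly p (complex_of_real x))) \<and>
     (\<forall>i\<in>{1..n}. \<exists>l r.
        (D (D u) \<longlongrightarrow> l) (at_left (\<xi> i)) \<and>
        (D (D u) \<longlongrightarrow> r) (at_right (\<xi> i)) \<and>
        r - l = c * complex_of_real (g i) * u (\<xi> i))"

definition phi :: "nat \<Rightarrow> (nat \<Rightarrow> real) \<Rightarrow> (nat \<Rightarrow> real) \<Rightarrow> complex \<Rightarrow> real \<Rightarrow> complex" where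
  "phi n \<xi> g z = (THE u. string_solution n \<xi> g (- z) u \<and>
     u 0 = 0 \<and> D u 0 = 0 \<and> D (D u) 0 = 1)"

definition phi_star :: "nat \<Rightarrow> (nat \<Rightarrow> real) \<Rightarrow> (nat \<Rightarrow> real) \<Rightarrow> nat \<Rightarrow>
    complex \<Rightarrow> real \<Rightarrow> complex" where
  "phi_star n \<xi> g a z = (THE u. string_solution n \<xi> g z u \<and>
     u 1 = (if a = 2 then 1 else 0) \<and>
     D u 1 = (if a = 1 then 1 else 0) \<and>
     D (D u) 1 = (if a = 0 then 1 else 0))"

text \<open>
  \<open>phi_end n \<xi> g k z\<close> is the \<open>k\<close>-th \<open>\<xi>\<close>-derivative of \<open>\<phi>(\<xi>;z)\<close> at \<open>\<xi> = 1\<close>.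
\<close>

definition phi_end :: "nat \<Rightarrow> (nat \<Rightarrow> real) \<Rightarrow> (nat \<Rightarrow> real) \<Rightarrow> nat \<Rightarrow> complex \<Rightarrow> complex" where
  "phi_end n \<xi> g k z = (D ^^ k) (phi n \<xi> g z) 1"

definition spectrum :: "nat \<Rightarrow> (nat \<Rightarrow> real) \<Rightarrow> (nat \<Rightarrow> real) \<Rightarrow> nat \<Rightarrow> complex set" where
  "spectrum n \<xi> g a = {z. phi_end n \<xi> g a z = 0}"

definition fourier :: "nat \<Rightarrow> (nat \<Rightarrow> real) \<Rightarrow> (nat \<Rightarrow> real) \<Rightarrow> nat \<Rightarrow>
    (real \<Rightarrow> complex) \<Rightarrow> complex \<Rightarrow> complex" where
  "fourier n \<xi> g a f z = (- 1) ^ a * inner_g n \<xi> g (phi_star n \<xi> g a z) f"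

text \<open>
  The weights \<open>A\<close> and \<open>B\<close> as functions of the spectral point, where \<open>deriv\<close> is
  \<open>\<partial>/\<partial>z\<close>; the type pairs \<open>(a,b)\<close> other than the four listed are not considered.
\<close>

definition weight_A :: "nat \<Rightarrow> (nat \<Rightarrow> real) \<Rightarrow> (nat \<Rightarrow> real) \<Rightarrow> nat \<Rightarrow> nat \<Rightarrow>
    complex \<Rightarrow> complex" where
  "weight_A n \<xi> g a b z =
    (if (a, b) = (0, 0) then phi_end n \<xi> g 1 z / deriv (phi_end n \<xi> g 0) z
     else if (a, b) = (0, 1) then phi_end n \<xi> g 2 z / deriv (phi_end n \<xi> g 0) z
     else if (a, b) = (1, 2) then phi_end n \<xi> g 2 z / deriv (phi_end n \<xi> g 1) z
     else if (a, b) = (2, 2) then - (phi_end n \<xi> g 1 z / deriv (phi_end n \<xi> g 2) z)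
     else undefined)"

definition weight_B :: "nat \<Rightarrow> (nat \<Rightarrow> real) \<Rightarrow> (nat \<Rightarrow> real) \<Rightarrow> nat \<Rightarrow> nat \<Rightarrow>
    complex \<Rightarrow> complex" where
  "weight_B n \<xi> g a b z =
    (if (a, b) = (0, 0) then phi_end n \<xi> g 1 z / deriv (phi_end n \<xi> g 0) z
     else if (a, b) = (0, 1) then - (phi_end n \<xi> g 0 z / deriv (phi_end n \<xi> g 1) z)
     else if (a, b) = (1, 2) then - (phi_end n \<xi> g 0 z / deriv (phi_end n \<xi> g 2) z)
     else if (a, b) = (2, 2) then - (phi_end n \<xi> g 1 z / deriv (phi_end n \<xi> g 2) z)
     else undefined)"

text \<open>
  The Borel measure on \<open>\<real>\<close> that is the sum over \<open>z \<in> S\<close> of \<open>w z\<close> times the point mass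
  at \<open>z\<close>. It is used only for finite \<open>S\<close> contained in the positive reals and weights that
  are positive on \<open>S\<close>, so \<open>Re\<close> and \<open>ennreal\<close> are mere type conversions there.
\<close>

definition discrete_measure :: "complex set \<Rightarrow> (complex \<Rightarrow> complex) \<Rightarrow> real measure" where
  "discrete_measure S w =
     distr (point_measure {x. complex_of_real x \<in> S} (\<lambda>x. ennreal (Re (w (complex_of_real x)))))
       borel (\<lambda>x. x)"

definition spectral_alpha :: "nat \<Rightarrow> (nat \<Rightarrow> real) \<Rightarrow> (nat \<Rightarrow> real) \<Rightarrow> nat \<Rightarrow> nat \<Rightarrow>
    real measure" where
  "spectral_alpha n \<xi> g a b = discrete_measure (spectrum n \<xi> g a) (weight_A n \<xi> g a b)"

definition spectral_beta :: "nat \<Rightarrow> (nat \<Rightarrow> real) \<Rightarrow> (nat \<Rightarrow> real) \<Rightarrow> nat \<Rightarrow> nat \<Rightarrow>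
    real measure" where
  "spectral_beta n \<xi> g a b = discrete_measure (spectrum n \<xi> g b) (weight_B n \<xi> g a b)"

text \<open>
  The pairing acts on the restrictions of \<open>p\<close> and \<open>q\<close> to the real line.
\<close>

definition cauchy_pairing :: "real measure \<Rightarrow> real measure \<Rightarrow>
    (complex \<Rightarrow> complex) \<Rightarrow> (complex \<Rightarrow> complex) \<Rightarrow> complex" where
  "cauchy_pairing \<alpha> \<beta> p q =
     (LINT x|\<alpha>. (LINT y|\<beta>.
        p (complex_of_real x) * q (complex_of_real y) / complex_of_real (x + y)))"

end

theory Submission
  imports Defs "HOL-Computational_Algebra.Fundamental_Theorem_Algebra"
    "Jordan_Normal_Form.Determinant"
begin

text \<open>
  Write \<open>\<phi>\<^sub>z\<close> for the vector of values \<open>\<phi>(\<xi>\<^sub>i; z)\<close> and \<open>\<psi>\<^sub>w\<close> for that of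
  \<open>(-1)\<^sup>a \<phi>\<^sub>a\<^sup>*(\<xi>\<^sub>i; w)\<close>. The bilinear concomitant gives
  \<open>(z - w) (\<phi>\<^sub>z, \<psi>\<^sub>w)\<^sub>g = P\<^sub>a(w) - P\<^sub>a(z)\<close>, where \<open>P\<^sub>a(z)\<close> is the \<open>a\<close>-th derivative of
  \<open>\<phi>\<close> at \<open>1\<close>. Hence, once \<open>P\<^sub>a\<close> is known to have \<open>n\<close> simple zeros, the \<open>\<phi>\<close> and \<open>\<psi>\<close> vectors
  at these zeros are biorthogonal bases, with diagonal pairings \<open>- P\<^sub>a'(z)\<close>. Expanding \<open>f\<close> in the
  eigenfunctions of type \<open>a\<close> and \<open>h\<close> in those of type \<open>b\<close> leaves the products
  \<open>(\<phi>\<^sub>x, \<phi>\<^sub>y)\<^sub>g\<close>; as \<open>(x + y) g \<phi>\<^sub>x \<phi>\<^sub>y\<close> is an exact derivative, these equal a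
  product of boundary values divided by \<open>x + y\<close>, which is the Cauchy kernel with the stated weights.

  For the zeros, put \<open>x = - z\<close>. If \<open>x\<close> lies in the upper half plane, then the directions of
  \<open>\<phi>\<close>, \<open>\<phi>'\<close>, \<open>\<phi>''\<close>, \<open>x \<phi>\<close> occur in this counterclockwise order within a half plane, and this
  persists along mass-free intervals and across masses. So quotients of the three boundary
  values have imaginary parts of constant sign in the upper half plane, which forces all zeros
  to be real and simple and fixes the signs of the residues, that is, of the weights.
\<close>

section \<open>Solutions as quadratic splines\<close>

definition pos_part :: "real \<Rightarrow> real" where
  "pos_part x = max 0 x"

lemma pos_part_square_half_has_derivative:
  "((\<lambda>x. (pos_part (x - t))\<^sup>2 / 2) has_real_derivative pos_part (x - t)) (at x)"
proof -
  consider "x < t" | "x > t" | "x = t" by linarith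
  then show ?thesis
  proof cases
    case 1
    have "((\<lambda>x. 0) has_real_derivative pos_part (x - t)) (at x)"
      using 1 by (simp add: pos_part_def)
    then show ?thesis
      by (rule has_field_derivative_transform_within_open[where S="{..<t}"])
        (use 1 in \<open>auto simp: pos_part_def\<close>)
  next
    case 2
    have "((\<lambda>x. (x - t)\<^sup>2 / 2) has_real_derivative pos_part (x - t)) (at x)"
      using 2 by (auto intro!: derivative_eq_intros simp: pos_part_def)
    then show ?thesis
      by (rule has_field_derivative_transform_within_open[where S="{t<..}"])
        (use 2 in \<open>auto simp: pos_part_def\<close>)
  next
    case 3
    have "((\<lambda>h. (pos_part h)\<^sup>2 / 2 / h) \<longlongrightarrow> 0) (at 0)"
    proof (rule Lim_null_comparison)
      show "\<forall>\<^sub>F h in at 0. norm ((pos_part h)\<^sup>2 / 2 / h) \<le> \<bar>h\<bar>"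
        by (rule eventuallyI) (auto simp: pos_part_def max_def power2_eq_square)
      show "((\<lambda>h::real. \<bar>h\<bar>) \<longlongrightarrow> 0) (at 0)"
        by (rule tendsto_rabs_zero) simp
    qed
    then show ?thesis
      using 3 by (simp add: DERIV_def pos_part_def)
  qed
qed

lemma pos_part_has_derivative:
  assumes "x \<noteq> t"
  shows "((\<lambda>x. pos_part (x - t)) has_real_derivative (if t < x then 1 else 0)) (at x)"
proof (cases "t < x")
  case True
  have "((\<lambda>x. x - t) has_real_derivative (if t < x then 1 else 0)) (at x)"
    using True by (auto intro!: derivative_eq_intros)
  then show ?thesis
    by (rule has_field_derivative_transform_within_open[where S="{t<..}"])
      (use True in \<open>auto simp: pos_part_def\<close>)
next
  case False
  have "((\<lambda>x. 0) has_real_derivative (if t < x then 1 else 0)) (at x)"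
    using False by simp
  then show ?thesis
    by (rule has_field_derivative_transform_within_open[where S="{..<t}"])
      (use False assms in \<open>auto simp: pos_part_def\<close>)
qed

lemma poly_of_real_has_vector_derivative:
  "((\<lambda>x. poly p (complex_of_real x)) has_vector_derivative
      poly (pderiv p) (complex_of_real x)) (at x within S)"
  by (rule has_vector_derivative_real_field) (rule poly_DERIV)

lemma D_eqI:
  assumes "(v has_vector_derivative d) (at x within {0..1})" "x \<in> {0..1}"
    and "\<And>y. y \<in> {0..1} \<Longrightarrow> u y = v y"
  shows "D u x = d"
  unfolding D_def
  using vector_derivative_within_cbox[of 0 1 x u d]
    has_vector_derivative_transform[OF assms(2,3,1)] assms(2)
  by simp

text \<open>Truncated-power form: each summand is C^1, and its second derivative jumps by exactly
  \<open>w j\<close> at \<open>\<xi> j\<close>. The regularity asked of a string solution is thus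
  built in; the unknowns are the initial quadratic \<open>p\<close> and the jumps
  \<open>w\<close>.\<close>

definition spline :: "nat \<Rightarrow> (nat \<Rightarrow> real) \<Rightarrow> (nat \<Rightarrow> complex) \<Rightarrow> complex poly \<Rightarrow> real \<Rightarrow> complex" where
  "spline n \<xi> w p x =
     poly p (complex_of_real x) + (\<Sum>j=1..n. w j * complex_of_real ((pos_part (x - \<xi> j))\<^sup>2 / 2))"

lemma spline_has_derivative:
  "(spline n \<xi> w p has_vector_derivative
     poly (pderiv p) (complex_of_real x) + (\<Sum>j=1..n. w j * complex_of_real (pos_part (x - \<xi> j))))
     (at x within S)"
  unfolding spline_def
  by (intro has_vector_derivative_add poly_of_real_has_vector_derivative has_vector_derivative_sum
      has_vector_derivative_mult_right has_vector_derivative_of_real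
      has_field_derivative_at_within[OF pos_part_square_half_has_derivative])

context
  fixes n :: nat and \<xi> :: "nat \<Rightarrow> real" and w :: "nat \<Rightarrow> complex" and p :: "complex poly"
    and u :: "real \<Rightarrow> complex"
  assumes u: "\<And>x. x \<in> {0..1} \<Longrightarrow> u x = spline n \<xi> w p x"
begin

lemma D_spline:
  assumes "x \<in> {0..1}"
  shows "D u x =
    poly (pderiv p) (complex_of_real x) + (\<Sum>j=1..n. w j * complex_of_real (pos_part (x - \<xi> j)))"
  using D_eqI[OF spline_has_derivative assms u] by simp

lemma DD_spline:
  assumes x: "x \<in> {0..1}" and "x \<notin> \<xi> ` {1..n}"
  shows "D (D u) x =
    poly (pderiv (pderiv p)) (complex_of_real x) + (\<Sum>j=1..n. if \<xi> j < x then w j else 0)"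
proof (rule D_eqI[OF _ x])
  have "((\<lambda>x. poly (pderiv p) (complex_of_real x) +
          (\<Sum>j=1..n. w j * complex_of_real (pos_part (x - \<xi> j)))) has_vector_derivative
        poly (pderiv (pderiv p)) (complex_of_real x) +
          (\<Sum>j=1..n. w j * complex_of_real (if \<xi> j < x then 1 else 0))) (at x within {0..1})"
    using assms
    by (intro has_vector_derivative_add poly_of_real_has_vector_derivative has_vector_derivative_sum
        has_vector_derivative_mult_right has_vector_derivative_of_real
        has_field_derivative_at_within[OF pos_part_has_derivative]) auto
  then show "((\<lambda>x. poly (pderiv p) (complex_of_real x) +
          (\<Sum>j=1..n. w j * complex_of_real (pos_part (x - \<xi> j)))) has_vector_derivative
        poly (pderiv (pderiv p)) (complex_of_real x) +
          (\<Sum>j=1..n. if \<xi> j < x then w j else 0)) (at x within {0..1})"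
    by (simp add: if_distrib cong: if_cong)
qed (rule D_spline)

end

section \<open>Mass points and mass-free intervals\<close>

lemma node_mono:
  assumes "cubic_string n \<xi> g" "i \<le> n"
  shows "node n \<xi> i < node n \<xi> (Suc i)"
proof -
  have s: "\<And>i j. \<lbrakk>1 \<le> i; i < j; j \<le> n\<rbrakk> \<Longrightarrow> \<xi> i < \<xi> j"
    using assms by (auto simp: cubic_string_def strict_mono_on_def)
  show ?thesis
    using assms s[of i "Suc i"] by (cases "i = n") (auto simp: node_def cubic_string_def)
qed

lemma node_strict_mono:
  assumes c: "cubic_string n \<xi> g" and "i < j" "j \<le> Suc n"
  shows "node n \<xi> i < node n \<xi> j"
  using assms(2,3)
proof (induction j)
  case (Suc j)
  show ?case
  proof (cases "i = j")
    case True
    then show ?thesis using node_mono[OF c, of j] Suc by simp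
  next
    case False
    then have "node n \<xi> i < node n \<xi> j" using Suc by simp
    also have "\<dots> < node n \<xi> (Suc j)" using node_mono[OF c, of j] Suc by simp
    finally show ?thesis .
  qed
qed simp

lemma node_range:
  assumes c: "cubic_string n \<xi> g" and "i \<le> Suc n"
  shows "node n \<xi> i \<in> {0..1}"
proof -
  have "node n \<xi> 0 \<le> node n \<xi> i" "node n \<xi> i \<le> node n \<xi> (Suc n)"
    using node_strict_mono[OF c, of 0 i] node_strict_mono[OF c, of i "Suc n"] assms
    by (cases "i = 0"; cases "i = Suc n"; force)+
  then show ?thesis by (simp add: node_def)
qed

lemma mass_point_in_interval:
  assumes "cubic_string n \<xi> g" "i \<in> {1..n}"
  shows "0 < \<xi> i" "\<xi> i < 1"
  using node_strict_mono[OF assms(1), of 0 i] node_strict_mono[OF assms(1), of i "Suc n"] assms(2)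
  by (auto simp: node_def)

lemma mass_points_ordered:
  assumes "cubic_string n \<xi> g" "i \<in> {1..n}" "j \<in> {1..n}"
  shows "\<xi> i < \<xi> j \<longleftrightarrow> i < j" "\<xi> i \<le> \<xi> j \<longleftrightarrow> i \<le> j" "\<xi> i = \<xi> j \<longleftrightarrow> i = j"
proof -
  have m: "strict_mono_on {1..n} \<xi>" using assms by (simp add: cubic_string_def)
  show 1: "\<xi> i < \<xi> j \<longleftrightarrow> i < j"
    using strict_mono_on_less[OF m] assms by simp
  show "\<xi> i \<le> \<xi> j \<longleftrightarrow> i \<le> j"
    using strict_mono_on_less_eq[OF m] assms by simp
  show "\<xi> i = \<xi> j \<longleftrightarrow> i = j"
    using strict_mono_on_eqD[OF m] assms by auto
qed

lemma node_cover:
  assumes c: "cubic_string n \<xi> g" and x: "x \<in> {0..1}"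
  obtains i where "i \<le> n" "x \<in> {node n \<xi> i..node n \<xi> (Suc i)}"
proof -
  \<comment> \<open>The last admissible node not beyond \<open>x\<close>. The bound
    \<open>i \<le> n\<close> puts \<open>x = 1\<close> into the last interval instead of selecting
    the node \<open>Suc n\<close>.\<close>
  define i where "i = Max {i. i \<le> n \<and> node n \<xi> i \<le> x}"
  have fin: "finite {i. i \<le> n \<and> node n \<xi> i \<le> x}" by simp
  have ne: "{i. i \<le> n \<and> node n \<xi> i \<le> x} \<noteq> {}"
    using x by (auto simp: node_def intro!: exI[of _ 0])
  have "i \<in> {i. i \<le> n \<and> node n \<xi> i \<le> x}"
    unfolding i_def by (rule Max_in[OF fin ne])
  then have i: "i \<le> n" "node n \<xi> i \<le> x" by simp_all
  have "x \<le> node n \<xi> (Suc i)"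
  proof (rule ccontr)
    assume *: "\<not> ?thesis"
    then have "i \<noteq> n" using x by (auto simp: node_def)
    then have "Suc i \<in> {i. i \<le> n \<and> node n \<xi> i \<le> x}" using i * by simp
    then have "Suc i \<le> i" unfolding i_def by (rule Max_ge[OF fin])
    then show False by simp
  qed
  then show ?thesis using i that by simp
qed

text \<open>Truncated squares of masses on the left are full squares, those of masses on the right
  vanish. At an end point both readings agree, so the closed interval is allowed.\<close>

lemma spline_on_piece:
  assumes c: "cubic_string n \<xi> g" and i: "i \<le> n" and x: "x \<in> {node n \<xi> i..node n \<xi> (Suc i)}"
  shows "spline n \<xi> w p x =
    poly p (complex_of_real x) + (\<Sum>j=1..i. w j * (complex_of_real x - complex_of_real (\<xi> j))\<^sup>2 / 2)"
proof -
  have 1: "\<xi> j \<le> x" if "j \<in> {1..i}" for j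
    using node_strict_mono[OF c, of j i] that i x by (cases "j = i") (auto simp: node_def)
  have 2: "x \<le> \<xi> j" if "j \<in> {i<..n}" for j
    using node_strict_mono[OF c, of "Suc i" j] that i x by (cases "j = Suc i") (auto simp: node_def)
  have "(\<Sum>j=1..n. w j * complex_of_real ((pos_part (x - \<xi> j))\<^sup>2 / 2)) =
    (\<Sum>j=1..i. w j * complex_of_real ((pos_part (x - \<xi> j))\<^sup>2 / 2)) +
    (\<Sum>j\<in>{i<..n}. w j * complex_of_real ((pos_part (x - \<xi> j))\<^sup>2 / 2))"
    using i by (subst sum.union_disjoint[symmetric]) (auto intro!: sum.cong)
  also have "(\<Sum>j\<in>{i<..n}. w j * complex_of_real ((pos_part (x - \<xi> j))\<^sup>2 / 2)) = 0"
    by (rule sum.neutral) (use 2 in \<open>auto simp: pos_part_def\<close>)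
  also have "(\<Sum>j=1..i. w j * complex_of_real ((pos_part (x - \<xi> j))\<^sup>2 / 2)) =
    (\<Sum>j=1..i. w j * (complex_of_real x - complex_of_real (\<xi> j))\<^sup>2 / 2)"
    by (rule sum.cong) (use 1 in \<open>auto simp: pos_part_def\<close>)
  finally show ?thesis by (simp add: spline_def)
qed

section \<open>Equivalence of quadratic splines and string solutions\<close>

lemma quadratic_taylor:
  fixes p :: "complex poly"
  assumes "degree p \<le> 2"
  shows "poly p x = poly p t + poly (pderiv p) t * (x - t) + poly (pderiv (pderiv p)) t * (x - t)\<^sup>2 / 2"
proof -
  have p: "p = [:coeff p 0, coeff p 1, coeff p 2:]"
  proof (rule poly_eqI)
    fix k
    show "coeff p k = coeff [:coeff p 0, coeff p 1, coeff p 2:] k"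
      using assms by (cases "k \<le> 2") (auto simp: le_Suc_eq numeral_2_eq_2 coeff_eq_0)
  qed
  obtain a b c where p: "p = [:a, b, c:]" using p by blast
  show ?thesis
    unfolding p by (simp add: pderiv_pCons power2_eq_square field_simps)
qed

lemma pderiv2_const:
  fixes p :: "complex poly"
  assumes "degree p \<le> 2"
  shows "poly (pderiv (pderiv p)) x = poly (pderiv (pderiv p)) t"
proof -
  have "degree (pderiv (pderiv p)) = 0" using assms by (simp add: degree_pderiv)
  then obtain a where "pderiv (pderiv p) = [:a:]" using degree_eq_zeroE by metis
  then show ?thesis by simp
qed

text \<open>Beyond the last mass, the spline with initial piece \<open>p\<close> is the quadratic \<open>p + end_poly\<close>.\<close>

definition end_poly :: "nat \<Rightarrow> (nat \<Rightarrow> real) \<Rightarrow> (nat \<Rightarrow> complex) \<Rightarrow> complex poly" where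
  "end_poly n \<xi> w = (\<Sum>j=1..n. Polynomial.smult (w j / 2) ([:- complex_of_real (\<xi> j), 1:]\<^sup>2))"

lemma degree_end_poly: "degree (end_poly n \<xi> w) \<le> 2"
  unfolding end_poly_def
proof (rule degree_sum_le)
  fix j
  have "degree ([:- complex_of_real (\<xi> j), 1:]\<^sup>2) \<le> 2"
    by (rule order_trans[OF degree_power_le]) simp
  then show "degree (Polynomial.smult (w j / 2) ([:- complex_of_real (\<xi> j), 1:]\<^sup>2)) \<le> 2"
    using degree_smult_le order_trans by blast
qed simp

lemma poly_end_poly:
  "poly (end_poly n \<xi> w) x = (\<Sum>j=1..n. w j * (x - complex_of_real (\<xi> j))\<^sup>2 / 2)"
  "poly (pderiv (end_poly n \<xi> w)) x = (\<Sum>j=1..n. w j * (x - complex_of_real (\<xi> j)))"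
  "poly (pderiv (pderiv (end_poly n \<xi> w))) x = (\<Sum>j=1..n. w j)"
  unfolding end_poly_def
  by (induction n)
    (simp_all add: pderiv_add pderiv_smult pderiv_mult pderiv_pCons power2_eq_square field_simps)

text \<open>Since the second derivative of the spline jumps by \<open>w i\<close> at
  \<open>\<xi> i\<close>, the differential equation reduces to consistency of \<open>w\<close> with
  the values of \<open>u\<close> at the masses.\<close>

lemma spline_is_solution:
  assumes c: "cubic_string n \<xi> g" and ext: "u \<in> extensional {0..1}" and deg: "degree p \<le> 2"
    and u: "\<And>x. x \<in> {0..1} \<Longrightarrow> u x = spline n \<xi> w p x"
    and w: "\<And>j. j \<in> {1..n} \<Longrightarrow> w j = c * complex_of_real (g j) * u (\<xi> j)"
  shows "string_solution n \<xi> g c u"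
  unfolding string_solution_def
proof (intro conjI ballI allI impI)
  show "u \<in> extensional {0..1}" by fact
  fix x :: real assume x: "x \<in> {0..1}"
  show "u differentiable (at x within {0..1})"
    using has_vector_derivative_transform[OF x u spline_has_derivative]
    by (auto intro: differentiableI_vector)
next
  have "continuous_on {0..1} (\<lambda>x. poly (pderiv p) (complex_of_real x) +
      (\<Sum>j=1..n. w j * complex_of_real (pos_part (x - \<xi> j))))"
    unfolding pos_part_def by (intro continuous_intros)
  then show "continuous_on {0..1} (D u)"
    by (rule continuous_on_eq) (rule D_spline[OF u, symmetric])
next
  fix i assume i: "i \<le> n"
  \<comment> \<open>\<open>end_poly\<close> with \<open>i\<close> in place of \<open>n\<close>
    collects only the masses up to the left end of the piece.\<close>
  define q where "q = p + end_poly i \<xi> w"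
  have "degree q \<le> 2"
    unfolding q_def by (intro degree_add_le deg degree_end_poly)
  moreover have "u x = poly q (complex_of_real x)" if "x \<in> {node n \<xi> i<..<node n \<xi> (Suc i)}" for x
  proof -
    have "u x = spline n \<xi> w p x"
      using that node_range[OF c, of i] node_range[OF c, of "Suc i"] i by (intro u) auto
    also have "\<dots> = poly q (complex_of_real x)"
      using spline_on_piece[OF c i, of x w p] that by (simp add: q_def poly_end_poly)
    finally show ?thesis .
  qed
  ultimately show "\<exists>p. degree p \<le> 2 \<and>
      (\<forall>x\<in>{node n \<xi> i<..<node n \<xi> (Suc i)}. u x = poly p (complex_of_real x))"
    by blast
next
  fix i assume i: "i \<in> {1..n}"
  define a where "a = poly (pderiv (pderiv p)) 0"
  \<comment> \<open>Between masses \<open>D (D u)\<close> is constant, namely \<open>a\<close> plus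
    a partial sum of jumps; the one-sided limits at \<open>\<xi> i\<close> are two consecutive such
    values.\<close>
  have DD: "D (D u) x = a + (\<Sum>j=1..k. w j)"
    if x: "x \<in> {node n \<xi> k<..<node n \<xi> (Suc k)}" and k: "k \<le> n" for x k
  proof -
    have lt: "\<xi> j < x \<longleftrightarrow> j \<le> k" "\<xi> j \<noteq> x" if "j \<in> {1..n}" for j
    proof -
      consider "j < k" | "j = k" | "j = Suc k" | "j > Suc k" by linarith
      then have "(\<xi> j < x \<longleftrightarrow> j \<le> k) \<and> \<xi> j \<noteq> x"
        using node_strict_mono[OF c, of j k] node_strict_mono[OF c, of "Suc k" j] that x k
        by cases (auto simp: node_def)
      then show "\<xi> j < x \<longleftrightarrow> j \<le> k" "\<xi> j \<noteq> x" by auto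
    qed
    have x01: "x \<in> {0..1}"
      using x node_range[OF c, of k] node_range[OF c, of "Suc k"] k by auto
    have "x \<notin> \<xi> ` {1..n}"
      using lt(2) by blast
    then have "D (D u) x = a + (\<Sum>j=1..n. if \<xi> j < x then w j else 0)"
      using DD_spline[OF u x01] pderiv2_const[OF deg, of "complex_of_real x" 0]
      by (simp add: a_def)
    also have "(\<Sum>j=1..n. if \<xi> j < x then w j else 0) = (\<Sum>j=1..n. if j \<le> k then w j else 0)"
      by (rule sum.cong) (use lt in auto)
    also have "\<dots> = (\<Sum>j=1..k. w j)"
      using k by (intro sum.mono_neutral_cong_right) auto
    finally show ?thesis .
  qed
  have nd: "node n \<xi> i = \<xi> i" using i by (simp add: node_def)
  have il: "node n \<xi> (i - 1) < \<xi> i" "\<xi> i < node n \<xi> (Suc i)"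
    using node_mono[OF c, of "i - 1"] node_mono[OF c, of i] i nd by auto
  have "\<forall>\<^sub>F x in at_left (\<xi> i). a + (\<Sum>j=1..i-1. w j) = D (D u) x"
    using eventually_at_left_real[OF il(1)]
  proof eventually_elim
    case (elim x)
    then show ?case using DD[of x "i - 1"] i nd by auto
  qed
  then have l: "(D (D u) \<longlongrightarrow> a + (\<Sum>j=1..i-1. w j)) (at_left (\<xi> i))"
    by (rule Lim_transform_eventually[OF tendsto_const])
  have "\<forall>\<^sub>F x in at_right (\<xi> i). a + (\<Sum>j=1..i. w j) = D (D u) x"
    using eventually_at_right_real[OF il(2)]
  proof eventually_elim
    case (elim x)
    then show ?case using DD[of x i] i nd by auto
  qed
  then have r: "(D (D u) \<longlongrightarrow> a + (\<Sum>j=1..i. w j)) (at_right (\<xi> i))"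
    by (rule Lim_transform_eventually[OF tendsto_const])
  have "(\<Sum>j=1..i. w j) = (\<Sum>j=1..i-1. w j) + w i"
    using i by (cases i) auto
  then show "\<exists>l r. (D (D u) \<longlongrightarrow> l) (at_left (\<xi> i)) \<and> (D (D u) \<longlongrightarrow> r) (at_right (\<xi> i)) \<and>
      r - l = c * complex_of_real (g i) * u (\<xi> i)"
    using l r w[OF i] by (intro exI[of _ "a + (\<Sum>j=1..i-1. w j)"] exI[of _ "a + (\<Sum>j=1..i. w j)"]) simp
qed

text \<open>Carries formulas for \<open>u\<close> and \<open>D u\<close> from the interior of a
  mass-free interval to its end points.\<close>

lemma continuous_agree_Icc:
  fixes f h :: "real \<Rightarrow> complex"
  assumes "continuous_on {0..1} f" "continuous_on {0..1} h" "a < b" "a \<in> {0..1}" "b \<in> {0..1}"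
    and eq: "\<And>x. x \<in> {a<..<b} \<Longrightarrow> f x = h x" and x: "x \<in> {a..b}"
  shows "f x = h x"
proof -
  have cl: "closure {a<..<b} = {a..b}" using assms by simp
  have "continuous_on {a..b} (\<lambda>x. f x - h x)"
    using assms by (intro continuous_on_diff) (auto elim: continuous_on_subset)
  then have "f x - h x = 0"
    using continuous_constant_on_closure[of "{a<..<b}" "\<lambda>x. f x - h x" 0 x] x eq
    unfolding cl by auto
  then show ?thesis by simp
qed

text \<open>The pieces on the two sides of a mass share value and slope there, so by Taylor
  expansion at the mass they differ by half the jump times a square. Summing these differences from
  the left leaves the first piece as the only free datum.\<close>

lemma solution_is_spline:
  assumes c: "cubic_string n \<xi> g" and sol: "string_solution n \<xi> g c u"
  obtains p where "degree p \<le> 2"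
    "\<And>x. x \<in> {0..1} \<Longrightarrow> u x = spline n \<xi> (\<lambda>j. c * complex_of_real (g j) * u (\<xi> j)) p x"
proof -
  define w where "w = (\<lambda>j. c * complex_of_real (g j) * u (\<xi> j))"
  from sol have diff: "\<And>x. x \<in> {0..1} \<Longrightarrow> u differentiable (at x within {0..1})"
    and contD: "continuous_on {0..1} (D u)"
    and pieces: "\<forall>i\<le>n. \<exists>p::complex poly. degree p \<le> 2 \<and>
        (\<forall>x\<in>{node n \<xi> i<..<node n \<xi> (Suc i)}. u x = poly p (complex_of_real x))"
    and jumps: "\<And>i. i \<in> {1..n} \<Longrightarrow> \<exists>l r.
        (D (D u) \<longlongrightarrow> l) (at_left (\<xi> i)) \<and> (D (D u) \<longlongrightarrow> r) (at_right (\<xi> i)) \<and> r - l = w i"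
    unfolding string_solution_def w_def by blast+
  have contu: "continuous_on {0..1} u"
    using diff differentiable_imp_continuous_on differentiable_on_def by blast
  from pieces obtain P :: "nat \<Rightarrow> complex poly" where deg: "\<And>i. i \<le> n \<Longrightarrow> degree (P i) \<le> 2"
    and P: "\<And>i x. \<lbrakk>i \<le> n; x \<in> {node n \<xi> i<..<node n \<xi> (Suc i)}\<rbrakk> \<Longrightarrow> u x = poly (P i) (complex_of_real x)"
    by metis
  have inner: "x \<in> {0..1}" if "i \<le> n" "x \<in> {node n \<xi> i..node n \<xi> (Suc i)}" for i x
    using that node_range[OF c, of i] node_range[OF c, of "Suc i"] by auto
  \<comment> \<open>Inside a mass-free interval the filter within \<open>{0..1}\<close> is the full
    one, so \<open>D\<close> can be read off from a local formula, first for \<open>u\<close> and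
    then for \<open>D u\<close>.\<close>
  have at: "at x within {0..1} = at x" if "i \<le> n" "x \<in> {node n \<xi> i<..<node n \<xi> (Suc i)}" for i x
  proof (rule at_within_interior)
    have "{node n \<xi> i<..<node n \<xi> (Suc i)} \<subseteq> {0..1}"
      using inner that(1) by fastforce
    then show "x \<in> interior {0..1}"
      using that(2) by (meson interior_maximal open_greaterThanLessThan subsetD)
  qed
  have D_piece: "D v x = poly (pderiv q) (complex_of_real x)"
    if "i \<le> n" "x \<in> {node n \<xi> i<..<node n \<xi> (Suc i)}"
      and "\<And>y. y \<in> {node n \<xi> i<..<node n \<xi> (Suc i)} \<Longrightarrow> v y = poly q (complex_of_real y)" for i x v q
  proof -
    have "(v has_vector_derivative poly (pderiv q) (complex_of_real x)) (at x)"
      by (rule has_vector_derivative_transform_within_open[OF poly_of_real_has_vector_derivative,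
            where S="{node n \<xi> i<..<node n \<xi> (Suc i)}"])
        (use that in auto)
    then show ?thesis
      unfolding D_def at[OF that(1,2)] by (rule vector_derivative_at)
  qed
  have D1: "D u x = poly (pderiv (P i)) (complex_of_real x)"
    if "i \<le> n" "x \<in> {node n \<xi> i<..<node n \<xi> (Suc i)}" for i x
    using D_piece[OF that] P that(1) by blast
  have D2: "D (D u) x = poly (pderiv (pderiv (P i))) (complex_of_real x)"
    if "i \<le> n" "x \<in> {node n \<xi> i<..<node n \<xi> (Suc i)}" for i x
    using D_piece[OF that] D1 that(1) by blast
  have P': "u x = poly (P i) (complex_of_real x)" "D u x = poly (pderiv (P i)) (complex_of_real x)"
    if "i \<le> n" "x \<in> {node n \<xi> i..node n \<xi> (Suc i)}" for i x
  proof -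
    have *: "node n \<xi> i < node n \<xi> (Suc i)" "node n \<xi> i \<in> {0..1}" "node n \<xi> (Suc i) \<in> {0..1}"
      using that node_mono[OF c, of i] node_range[OF c, of i] node_range[OF c, of "Suc i"] by simp_all
    have poly: "continuous_on {0..1} (\<lambda>x. poly q (complex_of_real x))" for q
      by (intro continuous_intros)
    show "u x = poly (P i) (complex_of_real x)"
      using continuous_agree_Icc[OF contu poly * P[OF that(1)] that(2)] .
    show "D u x = poly (pderiv (P i)) (complex_of_real x)"
      using continuous_agree_Icc[OF contD poly * D1[OF that(1)] that(2)] .
  qed
  have step: "poly (P i) x = poly (P (i - 1)) x + w i * (x - complex_of_real (\<xi> i))\<^sup>2 / 2"
    if i: "i \<in> {1..n}" for i x
  proof -
    have nd: "node n \<xi> i = \<xi> i" using i by (simp add: node_def)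
    have il: "node n \<xi> (i - 1) < \<xi> i" "\<xi> i < node n \<xi> (Suc i)"
      using node_mono[OF c, of "i - 1"] node_mono[OF c, of i] i nd by auto
    obtain l r where lr: "(D (D u) \<longlongrightarrow> l) (at_left (\<xi> i))" "(D (D u) \<longlongrightarrow> r) (at_right (\<xi> i))"
      "r - l = w i"
      using jumps[OF i] by blast
    have "\<forall>\<^sub>F x in at_left (\<xi> i). poly (pderiv (pderiv (P (i-1)))) (\<xi> i) = D (D u) x"
      using eventually_at_left_real[OF il(1)]
    proof eventually_elim
      case (elim x)
      then show ?case
        using D2[of "i-1" x] i nd pderiv2_const[OF deg, of "i-1" x "\<xi> i"] by auto
    qed
    then have "(D (D u) \<longlongrightarrow> poly (pderiv (pderiv (P (i-1)))) (\<xi> i)) (at_left (\<xi> i))"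
      by (rule Lim_transform_eventually[OF tendsto_const])
    with lr(1) have l: "l = poly (pderiv (pderiv (P (i-1)))) (\<xi> i)"
      using tendsto_unique trivial_limit_at_left_real by blast
    have "\<forall>\<^sub>F x in at_right (\<xi> i). poly (pderiv (pderiv (P i))) (\<xi> i) = D (D u) x"
      using eventually_at_right_real[OF il(2)]
    proof eventually_elim
      case (elim x)
      then show ?case
        using D2[of i x] i nd pderiv2_const[OF deg, of i x "\<xi> i"] by auto
    qed
    then have "(D (D u) \<longlongrightarrow> poly (pderiv (pderiv (P i))) (\<xi> i)) (at_right (\<xi> i))"
      by (rule Lim_transform_eventually[OF tendsto_const])
    with lr(2) have r: "r = poly (pderiv (pderiv (P i))) (\<xi> i)"
      using tendsto_unique trivial_limit_at_right_real by blast
    have e0: "poly (P i) (\<xi> i) = poly (P (i-1)) (\<xi> i)"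
      "poly (pderiv (P i)) (\<xi> i) = poly (pderiv (P (i-1))) (\<xi> i)"
      using P'[of i "\<xi> i"] P'[of "i-1" "\<xi> i"] i il nd by auto
    have e2: "poly (pderiv (pderiv (P i))) (\<xi> i) = poly (pderiv (pderiv (P (i-1)))) (\<xi> i) + w i"
      using lr(3) l r by (simp add: algebra_simps)
    have dg: "degree (P i) \<le> 2" "degree (P (i - 1)) \<le> 2"
      using deg i by auto
    show ?thesis
      using quadratic_taylor[OF dg(1), of x "\<xi> i"] quadratic_taylor[OF dg(2), of x "\<xi> i"]
      unfolding e0 e2 by (simp add: ring_distribs add_divide_distrib)
  qed
  have Pi: "poly (P i) x = poly (P 0) x + (\<Sum>j=1..i. w j * (x - complex_of_real (\<xi> j))\<^sup>2 / 2)"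
    if "i \<le> n" for i x
    using that
  proof (induction i)
    case (Suc i)
    then show ?case using step[of "Suc i" x] by simp
  qed simp
  have "u x = spline n \<xi> w (P 0) x" if x: "x \<in> {0..1}" for x
  proof -
    obtain i where i: "i \<le> n" "x \<in> {node n \<xi> i..node n \<xi> (Suc i)}"
      using node_cover[OF c x] .
    show ?thesis
      using P'(1)[OF i] Pi[OF i(1)] spline_on_piece[OF c i] by simp
  qed
  then show ?thesis
    using that[of "P 0"] deg[of 0] by (simp add: w_def)
qed

section \<open>Triangular recursions for the values at the masses\<close>

text \<open>Forward substitution for a strictly lower triangular system. The ring is general because
  the recursion runs over the complex numbers at fixed \<open>z\<close> and over real
  polynomials.\<close>

function forward_sol :: "(nat \<Rightarrow> 'a::comm_ring_1) \<Rightarrow> (nat \<Rightarrow> nat \<Rightarrow> 'a) \<Rightarrow> nat \<Rightarrow> 'a" where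
  "forward_sol s M k = s k + (\<Sum>j\<in>{1..<k}. M k j * forward_sol s M j)"
  by auto
termination by (relation "inv_image less_than (\<lambda>(s, M, k). k)") auto

declare forward_sol.simps [simp del]

function backward_sol :: "nat \<Rightarrow> (nat \<Rightarrow> 'a::comm_ring_1) \<Rightarrow> (nat \<Rightarrow> nat \<Rightarrow> 'a) \<Rightarrow> nat \<Rightarrow> 'a" where
  "backward_sol n s M k = s k + (\<Sum>j\<in>{k<..n}. M k j * backward_sol n s M j)"
  by auto
termination by (relation "inv_image less_than (\<lambda>(n, s, M, k). n - k)") auto

declare backward_sol.simps [simp del]

lemma forward_sol_unique:
  assumes "\<And>k. k \<in> {1..n} \<Longrightarrow> v k = s k + (\<Sum>j\<in>{1..<k}. M k j * v j)" and "k \<in> {1..n}"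
  shows "v k = forward_sol s M k"
  using assms(2)
proof (induction k rule: less_induct)
  case (less k)
  have "(\<Sum>j\<in>{1..<k}. M k j * v j) = (\<Sum>j\<in>{1..<k}. M k j * forward_sol s M j)"
    by (rule sum.cong) (use less in auto)
  then show ?case
    using assms(1)[OF less.prems] forward_sol.simps[of s M k] by simp
qed

lemma backward_sol_unique:
  assumes "\<And>k. k \<in> {1..n} \<Longrightarrow> v k = s k + (\<Sum>j\<in>{k<..n}. M k j * v j)" and "k \<in> {1..n}"
  shows "v k = backward_sol n s M k"
  using assms(2)
proof (induction "n - k" arbitrary: k rule: less_induct)
  case (less k)
  have "(\<Sum>j\<in>{k<..n}. M k j * v j) = (\<Sum>j\<in>{k<..n}. M k j * backward_sol n s M j)"
    by (rule sum.cong) (use less in auto)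
  then show ?case
    using assms(1)[OF less.prems] backward_sol.simps[of n s M k] by simp
qed

text \<open>A truncated square is the full square minus the square truncated on the other side. This
  moves the base point to the right end, so that terminal value problems can be treated like initial
  ones.\<close>

lemma spline_from_end:
  "spline n \<xi> w p x = poly (p + end_poly n \<xi> w) (complex_of_real x) -
     (\<Sum>j=1..n. w j * complex_of_real ((pos_part (\<xi> j - x))\<^sup>2 / 2))"
proof -
  have "v * complex_of_real ((pos_part (x - t))\<^sup>2 / 2) =
      v * (complex_of_real x - complex_of_real t)\<^sup>2 / 2 - v * complex_of_real ((pos_part (t - x))\<^sup>2 / 2)"
    for v t
    by (cases "x \<le> t") (auto simp: pos_part_def power2_commute)
  then show ?thesis
    unfolding spline_def by (simp only: poly_add poly_end_poly sum_subtractf add_diff_eq)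
qed

text \<open>
  The values of \<open>\<phi>\<close> and of \<open>\<phi>\<^sub>a\<^sup>*\<close> at the masses, computed from the left and from the right end;
  \<open>(-1)\<^sup>a end_kernel a\<close> is the terminal data polynomial of type \<open>a\<close>.
\<close>

definition mass_vec :: "(nat \<Rightarrow> real) \<Rightarrow> (nat \<Rightarrow> real) \<Rightarrow> complex \<Rightarrow> nat \<Rightarrow> complex" where
  "mass_vec \<xi> g z = forward_sol (\<lambda>i. complex_of_real ((\<xi> i)\<^sup>2 / 2))
     (\<lambda>i j. - z * complex_of_real (g j * ((\<xi> i - \<xi> j)\<^sup>2 / 2)))"

definition end_kernel :: "nat \<Rightarrow> real \<Rightarrow> real" where
  "end_kernel a t = (1 - t) ^ (2 - a) / fact (2 - a)"

definition star_vec ::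
  "nat \<Rightarrow> (nat \<Rightarrow> real) \<Rightarrow> (nat \<Rightarrow> real) \<Rightarrow> nat \<Rightarrow> complex \<Rightarrow> nat \<Rightarrow> complex" where
  "star_vec n \<xi> g a z = backward_sol n (\<lambda>i. (- 1) ^ a * complex_of_real (end_kernel a (\<xi> i)))
     (\<lambda>i j. - z * complex_of_real (g j * ((\<xi> j - \<xi> i)\<^sup>2 / 2)))"

lemma mass_vec_rec:
  "mass_vec \<xi> g z i = complex_of_real ((\<xi> i)\<^sup>2 / 2) -
     z * (\<Sum>j\<in>{1..<i}. complex_of_real (g j * ((\<xi> i - \<xi> j)\<^sup>2 / 2)) * mass_vec \<xi> g z j)"
  unfolding mass_vec_def by (subst forward_sol.simps) (simp add: sum_distrib_left sum_negf mult_ac)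

lemma star_vec_rec:
  "star_vec n \<xi> g a z i = (- 1) ^ a * complex_of_real (end_kernel a (\<xi> i)) -
     z * (\<Sum>j\<in>{i<..n}. complex_of_real (g j * ((\<xi> j - \<xi> i)\<^sup>2 / 2)) * star_vec n \<xi> g a z j)"
  unfolding star_vec_def by (subst backward_sol.simps) (simp add: sum_distrib_left sum_negf mult_ac)

context
  fixes n :: nat and \<xi> g :: "nat \<Rightarrow> real"
  assumes c: "cubic_string n \<xi> g"
begin

text \<open>The mass at \<open>\<xi> i\<close> and all later ones contribute nothing at
  \<open>\<xi> i\<close>, which makes the equations for the values at the masses triangular.\<close>

lemma spline_at_mass:
  assumes i: "i \<in> {1..n}"
  shows "spline n \<xi> w p (\<xi> i) =
    poly p (complex_of_real (\<xi> i)) + (\<Sum>j\<in>{1..<i}. w j * complex_of_real ((\<xi> i - \<xi> j)\<^sup>2 / 2))"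
proof -
  have "(\<Sum>j=1..n. w j * complex_of_real ((pos_part (\<xi> i - \<xi> j))\<^sup>2 / 2)) =
    (\<Sum>j\<in>{1..<i}. w j * complex_of_real ((\<xi> i - \<xi> j)\<^sup>2 / 2))"
    using mass_points_ordered(2)[OF c _ i] mass_points_ordered(2,3)[OF c i] i
    by (intro sum.mono_neutral_cong_right ballI) (auto simp: pos_part_def max_def)
  then show ?thesis by (simp add: spline_def)
qed

lemma spline_at_mass_from_end:
  assumes i: "i \<in> {1..n}"
  shows "spline n \<xi> w p (\<xi> i) = poly (p + end_poly n \<xi> w) (complex_of_real (\<xi> i)) -
    (\<Sum>j\<in>{i<..n}. w j * complex_of_real ((\<xi> j - \<xi> i)\<^sup>2 / 2))"
proof -
  have "(\<Sum>j=1..n. w j * complex_of_real ((pos_part (\<xi> j - \<xi> i))\<^sup>2 / 2)) =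
    (\<Sum>j\<in>{i<..n}. w j * complex_of_real ((\<xi> j - \<xi> i)\<^sup>2 / 2))"
    using mass_points_ordered(2)[OF c _ i] mass_points_ordered(2,3)[OF c i] i
    by (intro sum.mono_neutral_cong_right ballI) (auto simp: pos_part_def max_def)
  then show ?thesis by (simp add: spline_from_end)
qed

context
  fixes w :: "nat \<Rightarrow> complex" and p :: "complex poly" and u :: "real \<Rightarrow> complex"
  assumes u: "\<And>x. x \<in> {0..1} \<Longrightarrow> u x = spline n \<xi> w p x"
begin

lemma spline_initial_data:
  "u 0 = poly p 0" "D u 0 = poly (pderiv p) 0" "D (D u) 0 = poly (pderiv (pderiv p)) 0"
proof -
  have pos: "\<And>j. j \<in> {1..n} \<Longrightarrow> 0 < \<xi> j" using mass_point_in_interval[OF c] by simp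
  have "(\<Sum>j=1..n. w j * complex_of_real ((pos_part (0 - \<xi> j))\<^sup>2 / 2)) = 0"
    by (rule sum.neutral) (use pos in \<open>force simp: pos_part_def\<close>)
  then show "u 0 = poly p 0" by (simp add: u spline_def)
  have "(\<Sum>j=1..n. w j * complex_of_real (pos_part (0 - \<xi> j))) = 0"
    by (rule sum.neutral) (use pos in \<open>force simp: pos_part_def\<close>)
  then show "D u 0 = poly (pderiv p) 0" using D_spline[OF u, of 0] by simp
  have "(\<Sum>j=1..n. if \<xi> j < 0 then w j else 0) = 0"
    by (rule sum.neutral) (use pos in force)
  moreover have "0 \<notin> \<xi> ` {1..n}" using pos by force
  ultimately show "D (D u) 0 = poly (pderiv (pderiv p)) 0"
    using DD_spline[OF u, of 0] by simp
qed

lemma spline_terminal_data: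
  "u 1 = poly (p + end_poly n \<xi> w) 1" "D u 1 = poly (pderiv (p + end_poly n \<xi> w)) 1"
  "D (D u) 1 = poly (pderiv (pderiv (p + end_poly n \<xi> w))) 1"
proof -
  have lt: "\<And>j. j \<in> {1..n} \<Longrightarrow> \<xi> j < 1" using mass_point_in_interval[OF c] by simp
  have "(\<Sum>j=1..n. w j * complex_of_real ((pos_part (1 - \<xi> j))\<^sup>2 / 2)) =
      (\<Sum>j=1..n. w j * (1 - complex_of_real (\<xi> j))\<^sup>2 / 2)"
    by (rule sum.cong) (use lt in \<open>force simp: pos_part_def\<close>)+
  then show "u 1 = poly (p + end_poly n \<xi> w) 1"
    by (simp add: u spline_def poly_end_poly)
  have "(\<Sum>j=1..n. w j * complex_of_real (pos_part (1 - \<xi> j))) =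
      (\<Sum>j=1..n. w j * (1 - complex_of_real (\<xi> j)))"
    by (rule sum.cong) (use lt in \<open>force simp: pos_part_def\<close>)+
  then show "D u 1 = poly (pderiv (p + end_poly n \<xi> w)) 1"
    using D_spline[OF u, of 1] by (simp add: pderiv_add poly_end_poly)
  have "(\<Sum>j=1..n. if \<xi> j < 1 then w j else 0) = (\<Sum>j=1..n. w j)"
    by (rule sum.cong) (use lt in auto)
  moreover have "1 \<notin> \<xi> ` {1..n}" using lt by force
  ultimately show "D (D u) 1 = poly (pderiv (pderiv (p + end_poly n \<xi> w))) 1"
    using DD_spline[OF u, of 1] by (simp add: pderiv_add poly_end_poly)
qed

end

section \<open>Identification of \<phi> and of the adjoint solutions\<close>

text \<open>The quadratic \<open>[:0, 0, 1 / 2:]\<close> encodes the initial data. Existence: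
  \<open>mass_vec\<close> obeys the recursion of the spline values, so the jumps are consistent.
  Uniqueness: a competitor is again a spline; its initial data fix its first piece, and forward
  substitution fixes its values at the masses and hence its jumps.\<close>

lemma phi_eq_spline:
  fixes z :: complex
  defines "w \<equiv> (\<lambda>j. - z * complex_of_real (g j) * mass_vec \<xi> g z j)"
  assumes x: "x \<in> {0..1}"
  shows "phi n \<xi> g z x = spline n \<xi> w [:0, 0, 1 / 2:] x"
proof -
  define u where "u = restrict (spline n \<xi> w [:0, 0, 1 / 2:]) {0..1}"
  have u: "u x = spline n \<xi> w [:0, 0, 1 / 2:] x" if "x \<in> {0..1}" for x
    using that by (simp add: u_def)
  have mass: "u (\<xi> i) = mass_vec \<xi> g z i" if i: "i \<in> {1..n}" for i
  proof -
    have "u (\<xi> i) = complex_of_real ((\<xi> i)\<^sup>2 / 2) +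
        (\<Sum>j\<in>{1..<i}. w j * complex_of_real ((\<xi> i - \<xi> j)\<^sup>2 / 2))"
      using mass_point_in_interval[OF c i] spline_at_mass[OF i, of w]
      by (simp add: u power2_eq_square)
    also have "\<dots> = mass_vec \<xi> g z i"
      by (subst mass_vec_rec) (simp add: w_def sum_distrib_left sum_negf mult_ac)
    finally show ?thesis .
  qed
  have sol: "string_solution n \<xi> g (- z) u"
  proof (rule spline_is_solution[OF c _ _ u])
    show "u \<in> extensional {0..1}" by (simp add: u_def)
  qed (auto simp: mass w_def)
  have data: "u 0 = 0 \<and> D u 0 = 0 \<and> D (D u) 0 = 1"
    using spline_initial_data[OF u] by (simp add: pderiv_pCons)
  have "phi n \<xi> g z = u"
    unfolding phi_def
  proof (rule the_equality)
    show "string_solution n \<xi> g (- z) u \<and> u 0 = 0 \<and> D u 0 = 0 \<and> D (D u) 0 = 1"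
      using sol data by simp
    fix v assume v: "string_solution n \<xi> g (- z) v \<and> v 0 = 0 \<and> D v 0 = 0 \<and> D (D v) 0 = 1"
    then obtain q where q: "degree q \<le> 2"
      and vq: "\<And>x. x \<in> {0..1} \<Longrightarrow>
        v x = spline n \<xi> (\<lambda>j. - z * complex_of_real (g j) * v (\<xi> j)) q x"
      using solution_is_spline[OF c, of "- z" v] by blast
    have "poly q 0 = 0" "poly (pderiv q) 0 = 0" "poly (pderiv (pderiv q)) 0 = 1"
      using spline_initial_data[OF vq] v by simp_all
    then have q': "poly q x = poly [:0, 0, 1 / 2:] x" for x
      using quadratic_taylor[OF q, of x 0] by (simp add: power2_eq_square)
    have rec: "v (\<xi> i) = complex_of_real ((\<xi> i)\<^sup>2 / 2) +
        (\<Sum>j\<in>{1..<i}. - z * complex_of_real (g j * ((\<xi> i - \<xi> j)\<^sup>2 / 2)) * v (\<xi> j))"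
      if i: "i \<in> {1..n}" for i
      using vq[of "\<xi> i"] mass_point_in_interval[OF c i] q'
        spline_at_mass[OF i, of "\<lambda>j. - z * complex_of_real (g j) * v (\<xi> j)" q]
      by (simp add: power2_eq_square mult_ac)
    have vm: "v (\<xi> i) = mass_vec \<xi> g z i" if "i \<in> {1..n}" for i
      unfolding mass_vec_def using forward_sol_unique[where v="\<lambda>i. v (\<xi> i)", OF rec that] .
    show "v = u"
    proof
      fix x
      show "v x = u x"
      proof (cases "x \<in> {0..1}")
        case True
        then show ?thesis
          using u vq q' by (simp add: spline_def w_def vm)
      next
        case False
        then have "v x = undefined"
          using v extensional_arb[of v "{0..1}" x] by (simp add: string_solution_def)
        with False show ?thesis
          unfolding u_def restrict_def by auto
      qed
    qed
  qed
  with u[OF x] show ?thesis by simp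
qed

text \<open>\<open>end_kernel a t\<close> is the \<open>a\<close>-th derivative of
  \<open>(x - t)^2 / 2\<close> at \<open>x = 1\<close>. The initial piece contributes the term with
  \<open>t = 0\<close>, the masses contribute the others.\<close>

lemma phi_end_eq:
  assumes "a \<le> 2"
  shows "phi_end n \<xi> g a z = complex_of_real (end_kernel a 0) -
    z * (\<Sum>j=1..n. complex_of_real (g j * end_kernel a (\<xi> j)) * mass_vec \<xi> g z j)"
proof -
  note data = spline_terminal_data[OF phi_eq_spline, of z]
  consider "a = 0" | "a = 1" | "a = 2" using assms by linarith
  then show ?thesis
  proof cases
    case 1
    then show ?thesis
      using data(1)
      by (simp add: phi_end_def end_kernel_def poly_end_poly sum_distrib_left sum_negf fact_numeral
          mult_ac)
  next
    case 2
    then show ?thesis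
      using data(2)
      by (simp add: phi_end_def end_kernel_def poly_end_poly sum_distrib_left sum_negf
          pderiv_add pderiv_pCons mult_ac)
  next
    case 3
    then show ?thesis
      using data(3)
      by (simp add: phi_end_def end_kernel_def poly_end_poly sum_distrib_left sum_negf
          pderiv_add pderiv_pCons mult_ac eval_nat_numeral)
  qed
qed

text \<open>Mirror image of \<open>phi_eq_spline\<close>: expansion from the right end makes the
  recursion start at the last mass, and backward substitution gives uniqueness.\<close>

lemma phi_star_mass:
  assumes a: "a \<le> 2" and i: "i \<in> {1..n}"
  shows "phi_star n \<xi> g a z (\<xi> i) = star_vec n \<xi> g a z i"
proof -
  define w where "w = (\<lambda>j. z * complex_of_real (g j) * star_vec n \<xi> g a z j)"
  \<comment> \<open>The quadratic with the terminal data of type \<open>a\<close> at 1: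
    \<open>(x - 1)^2 / 2\<close>, \<open>x - 1\<close> or 1.\<close>
  define e :: "complex poly" where "e = (if a = 0 then [:1/2, - 1, 1/2:] else if a = 1 then [:- 1, 1:] else [:1:])"
  have dege: "degree e \<le> 2" by (auto simp: e_def)
  have e: "poly e (complex_of_real x) = (- 1) ^ a * complex_of_real (end_kernel a x)" for x
  proof -
    consider "a = 0" | "a = 1" | "a = 2" using a by linarith
    then show ?thesis
      by cases (auto simp: e_def end_kernel_def power2_eq_square field_simps)
  qed
  have edata: "poly e 1 = (if a = 2 then 1 else 0)" "poly (pderiv e) 1 = (if a = 1 then 1 else 0)"
     "poly (pderiv (pderiv e)) 1 = (if a = 0 then 1 else 0)"
    using a by (auto simp: e_def pderiv_pCons)
  \<comment> \<open>The initial piece for which the spline equals \<open>e\<close> beyond the last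
    mass.\<close>
  define p where "p = e - end_poly n \<xi> w"
  have degp: "degree p \<le> 2" unfolding p_def by (intro degree_diff_le dege degree_end_poly)
  have pe: "p + end_poly n \<xi> w = e" by (simp add: p_def)
  define u where "u = restrict (spline n \<xi> w p) {0..1}"
  have u: "u x = spline n \<xi> w p x" if "x \<in> {0..1}" for x
    using that by (simp add: u_def)
  have mass: "u (\<xi> i) = star_vec n \<xi> g a z i" if i: "i \<in> {1..n}" for i
  proof -
    have "u (\<xi> i) = (- 1) ^ a * complex_of_real (end_kernel a (\<xi> i)) -
        (\<Sum>j\<in>{i<..n}. w j * complex_of_real ((\<xi> j - \<xi> i)\<^sup>2 / 2))"
      using mass_point_in_interval[OF c i] spline_at_mass_from_end[OF i, of w p]
      by (simp add: u pe e)
    also have "\<dots> = star_vec n \<xi> g a z i"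
      by (subst star_vec_rec) (simp add: w_def sum_distrib_left sum_negf mult_ac)
    finally show ?thesis .
  qed
  have sol: "string_solution n \<xi> g z u"
  proof (rule spline_is_solution[OF c _ degp u])
    show "u \<in> extensional {0..1}" by (simp add: u_def)
  qed (auto simp: mass w_def)
  have data: "u 1 = (if a = 2 then 1 else 0) \<and> D u 1 = (if a = 1 then 1 else 0) \<and>
     D (D u) 1 = (if a = 0 then 1 else 0)"
    using spline_terminal_data[OF u] edata by (simp add: pe)
  have "phi_star n \<xi> g a z = u"
    unfolding phi_star_def
  proof (rule the_equality)
    show "string_solution n \<xi> g z u \<and> u 1 = (if a = 2 then 1 else 0) \<and>
        D u 1 = (if a = 1 then 1 else 0) \<and> D (D u) 1 = (if a = 0 then 1 else 0)"
      using sol data by simp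
    fix v assume v: "string_solution n \<xi> g z v \<and> v 1 = (if a = 2 then 1 else 0) \<and>
        D v 1 = (if a = 1 then 1 else 0) \<and> D (D v) 1 = (if a = 0 then 1 else 0)"
    define w' where "w' = (\<lambda>j. z * complex_of_real (g j) * v (\<xi> j))"
    obtain q where q: "degree q \<le> 2" and vq: "\<And>x. x \<in> {0..1} \<Longrightarrow> v x = spline n \<xi> w' q x"
      using solution_is_spline[OF c, of z v] v unfolding w'_def by blast
    define e' where "e' = q + end_poly n \<xi> w'"
    have "degree e' \<le> 2" unfolding e'_def by (intro degree_add_le q degree_end_poly)
    then have e': "poly e' x = poly e x" for x
      using quadratic_taylor[of e' x 1] quadratic_taylor[OF dege, of x 1]
        spline_terminal_data[OF vq] v edata
      by (simp add: e'_def)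
    have rec: "v (\<xi> i) = (- 1) ^ a * complex_of_real (end_kernel a (\<xi> i)) +
        (\<Sum>j\<in>{i<..n}. - z * complex_of_real (g j * ((\<xi> j - \<xi> i)\<^sup>2 / 2)) * v (\<xi> j))"
      if i: "i \<in> {1..n}" for i
      using vq[of "\<xi> i"] mass_point_in_interval[OF c i] e'[of "\<xi> i"]
        spline_at_mass_from_end[OF i, of w' q]
      by (simp add: w'_def[symmetric] e'_def[symmetric] e) (simp add: w'_def mult_ac sum_negf)
    have vm: "v (\<xi> i) = star_vec n \<xi> g a z i" if "i \<in> {1..n}" for i
      unfolding star_vec_def using backward_sol_unique[where v="\<lambda>i. v (\<xi> i)", OF rec that] .
    have ww: "w' j = w j" if "j \<in> {1..n}" for j
      using vm that by (simp add: w_def w'_def)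
    show "v = u"
    proof
      fix x
      show "v x = u x"
      proof (cases "x \<in> {0..1}")
        case True
        then show ?thesis
          using u vq e' ww unfolding spline_from_end pe e'_def[symmetric] by simp
      next
        case False
        then have "v x = undefined"
          using v extensional_arb[of v "{0..1}" x] by (simp add: string_solution_def)
        with False show ?thesis
          unfolding u_def restrict_def by auto
      qed
    qed
  qed
  with mass[OF i] show ?thesis by simp
qed

end

section \<open>Bilinear identities\<close>

text \<open>Discrete Lagrange identity. Pairing the equation for \<open>f\<close> with
  \<open>\<psi>\<close> and that for \<open>\<psi>\<close> with \<open>f\<close> produces the same
  double sum \<open>S\<close>, because the kernels are transposes of each other; the terms
  \<open>z w S\<close> then cancel.\<close>

lemma concomitant_adjoint:
  fixes f \<psi> v q G :: "'i \<Rightarrow> 'a::comm_ring_1" and K :: "'i \<Rightarrow> 'i \<Rightarrow> 'a"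
  assumes f: "\<And>i. i \<in> I \<Longrightarrow> f i = v i - z * (\<Sum>j\<in>I. K i j * (G j * f j))"
    and \<psi>: "\<And>i. i \<in> I \<Longrightarrow> \<psi> i = q i - w * (\<Sum>j\<in>I. K j i * (G j * \<psi> j))"
  shows "(z - w) * (\<Sum>i\<in>I. G i * f i * \<psi> i) =
    z * (\<Sum>i\<in>I. G i * q i * f i) - w * (\<Sum>i\<in>I. G i * v i * \<psi> i)"
proof -
  define S where "S = (\<Sum>i\<in>I. \<Sum>j\<in>I. G i * \<psi> i * K i j * G j * f j)"
  have "(\<Sum>i\<in>I. G i * v i * \<psi> i) =
      (\<Sum>i\<in>I. G i * \<psi> i * (f i + z * (\<Sum>j\<in>I. K i j * (G j * f j))))"
    by (rule sum.cong) (simp_all add: f mult_ac)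
  also have "\<dots> = (\<Sum>i\<in>I. G i * f i * \<psi> i) + z * S"
    by (simp add: S_def distrib_left sum.distrib sum_distrib_left mult_ac)
  finally have 1: "(\<Sum>i\<in>I. G i * v i * \<psi> i) = (\<Sum>i\<in>I. G i * f i * \<psi> i) + z * S" .
  have "(\<Sum>i\<in>I. G i * q i * f i) =
      (\<Sum>i\<in>I. G i * f i * (\<psi> i + w * (\<Sum>j\<in>I. K j i * (G j * \<psi> j))))"
    by (rule sum.cong) (simp_all add: \<psi> mult_ac)
  also have "\<dots> = (\<Sum>i\<in>I. G i * f i * \<psi> i) +
      w * (\<Sum>i\<in>I. \<Sum>j\<in>I. G j * \<psi> j * K j i * G i * f i)"
    by (simp add: distrib_left sum.distrib sum_distrib_left mult_ac)
  also have "(\<Sum>i\<in>I. \<Sum>j\<in>I. G j * \<psi> j * K j i * G i * f i) = S"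
    unfolding S_def by (rule sum.swap)
  finally have 2: "(\<Sum>i\<in>I. G i * q i * f i) = (\<Sum>i\<in>I. G i * f i * \<psi> i) + w * S" .
  show ?thesis unfolding 1 2 by (simp add: algebra_simps)
qed

text \<open>Both equations carry the same kernel, so the mutual pairings produce two different
  double sums \<open>A\<close> and \<open>B\<close>. Their sum is accessible: \<open>K\<close> plus
  its transpose is half the square of a difference, which splits into three products of single sums,
  the mixed terms of the boundary products.\<close>

lemma concomitant_self:
  fixes f h G e :: "'i \<Rightarrow> 'a::field_char_0" and K :: "'i \<Rightarrow> 'i \<Rightarrow> 'a"
  assumes f: "\<And>i. i \<in> I \<Longrightarrow> f i = (1 - e i)\<^sup>2 / 2 - x * (\<Sum>j\<in>I. K i j * (G j * f j))"
    and h: "\<And>i. i \<in> I \<Longrightarrow> h i = (1 - e i)\<^sup>2 / 2 - y * (\<Sum>j\<in>I. K i j * (G j * h j))"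
    and K: "\<And>i j. \<lbrakk>i \<in> I; j \<in> I\<rbrakk> \<Longrightarrow> K i j + K j i = (e i - e j)\<^sup>2 / 2"
  shows "(x + y) * (\<Sum>i\<in>I. G i * f i * h i) =
    (1 - x * (\<Sum>i\<in>I. G i * e i * f i)) * (1 - y * (\<Sum>i\<in>I. G i * e i * h i))
    - (1 - x * (\<Sum>i\<in>I. G i * f i)) * (1 / 2 - y * (\<Sum>i\<in>I. G i * ((e i)\<^sup>2 / 2) * h i))
    - (1 / 2 - x * (\<Sum>i\<in>I. G i * ((e i)\<^sup>2 / 2) * f i)) * (1 - y * (\<Sum>i\<in>I. G i * h i))"
proof -
  define Q A B S0 S1 S2 T0 T1 T2 where "Q = (\<Sum>i\<in>I. G i * f i * h i)"
    and "A = (\<Sum>i\<in>I. \<Sum>j\<in>I. G i * f i * (K i j * (G j * h j)))"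
    and "B = (\<Sum>i\<in>I. \<Sum>j\<in>I. G i * f i * (K j i * (G j * h j)))"
    and "S0 = (\<Sum>i\<in>I. G i * f i)" and "S1 = (\<Sum>i\<in>I. G i * e i * f i)"
    and "S2 = (\<Sum>i\<in>I. G i * ((e i)\<^sup>2 / 2) * f i)"
    and "T0 = (\<Sum>i\<in>I. G i * h i)" and "T1 = (\<Sum>i\<in>I. G i * e i * h i)"
    and "T2 = (\<Sum>i\<in>I. G i * ((e i)\<^sup>2 / 2) * h i)"
  have B': "B = (\<Sum>i\<in>I. \<Sum>j\<in>I. G i * h i * (K i j * (G j * f j)))"
    unfolding B_def by (subst sum.swap) (simp add: mult_ac)
  have sq: "(1 - e i)\<^sup>2 / 2 = 1 / 2 - e i + (e i)\<^sup>2 / 2" for i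
    by (simp add: power2_eq_square field_simps)
  have "(\<Sum>i\<in>I. G i * f i * ((1 - e i)\<^sup>2 / 2)) =
      (\<Sum>i\<in>I. G i * f i * (h i + y * (\<Sum>j\<in>I. K i j * (G j * h j))))"
    by (rule sum.cong) (simp_all add: h)
  also have "\<dots> = Q + y * A"
    by (simp add: Q_def A_def distrib_left sum.distrib sum_distrib_left mult_ac)
  finally have 1: "S0 / 2 - S1 + S2 = Q + y * A"
    unfolding sq by (simp add: S0_def S1_def S2_def distrib_left right_diff_distrib sum.distrib
        sum_subtractf sum_divide_distrib mult_ac)
  have "(\<Sum>i\<in>I. G i * h i * ((1 - e i)\<^sup>2 / 2)) =
      (\<Sum>i\<in>I. G i * h i * (f i + x * (\<Sum>j\<in>I. K i j * (G j * f j))))"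
    by (rule sum.cong) (simp_all add: f)
  also have "\<dots> = Q + x * B"
    by (simp add: Q_def B' distrib_left sum.distrib sum_distrib_left mult_ac)
  finally have 2: "T0 / 2 - T1 + T2 = Q + x * B"
    unfolding sq by (simp add: T0_def T1_def T2_def distrib_left right_diff_distrib sum.distrib
        sum_subtractf sum_divide_distrib mult_ac)
  have "A + B = (\<Sum>i\<in>I. \<Sum>j\<in>I. G i * f i * ((K i j + K j i) * (G j * h j)))"
    unfolding A_def B_def by (simp add: sum.distrib algebra_simps)
  also have "\<dots> = (\<Sum>i\<in>I. \<Sum>j\<in>I. G i * f i * (G j * ((e j)\<^sup>2 / 2) * h j)
      - G i * e i * f i * (G j * e j * h j) + G i * ((e i)\<^sup>2 / 2) * f i * (G j * h j))"
    by (intro sum.cong refl) (simp add: K power2_eq_square field_simps)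
  also have "\<dots> = S0 * T2 - S1 * T1 + S2 * T0"
    by (simp add: S0_def S1_def S2_def T0_def T1_def T2_def sum.distrib sum_subtractf sum_product)
  finally have 3: "A + B = S0 * T2 - S1 * T1 + S2 * T0" .
  \<comment> \<open>By the two pairings the terms linear in the \<open>S\<close> and
    \<open>T\<close> sums amount to \<open>(x + y) Q + x y (A + B)\<close>; the last term cancels
    the product of sums.\<close>
  have "(1 - x * S1) * (1 - y * T1) - (1 - x * S0) * (1 / 2 - y * T2) - (1 / 2 - x * S2) * (1 - y * T0)
     = x * (S0 / 2 - S1 + S2) + y * (T0 / 2 - T1 + T2) - x * y * (S0 * T2 - S1 * T1 + S2 * T0)"
    by (simp add: field_simps)
  also have "\<dots> = (x + y) * Q"
    unfolding 1 2 3[symmetric] by (simp add: algebra_simps)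
  finally show ?thesis
    unfolding Q_def S0_def S1_def S2_def T0_def T1_def T2_def by simp
qed

section \<open>Zeros of the boundary values\<close>

text \<open>
  Here \<open>(a, b, c)\<close> stands for \<open>(\<phi>, \<phi>', \<phi>'')\<close>, and the hypotheses say that \<open>a, b, c, x a\<close> have
  increasing arguments within a half plane. The equations with a product of two imaginary parts on
  each side are instances of the Pluecker relation
  \<open>[a,c] b = [b,c] a + [a,b] c\<close> for \<open>[u,v] = Im (v * cnj u)\<close>.
\<close>

lemma cone_step_free:
  fixes a b c x :: complex and l :: real
  assumes "0 \<le> Im (b * cnj a)" "0 < Im (c * cnj a)" "0 < Im (c * cnj b)"
    "0 < Im (x * a * cnj c)" "0 < Im x" "0 < l"
  defines "a' \<equiv> a + of_real l * b + of_real (l\<^sup>2 / 2) * c" and "b' \<equiv> b + of_real l * c"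
  shows "0 < Im (b' * cnj a')" "0 < Im (c * cnj a')" "0 < Im (c * cnj b')" "0 < Im (x * a' * cnj c)"
proof -
  have "Im (b' * cnj a') = Im (b * cnj a) + l * Im (c * cnj a) + l\<^sup>2 / 2 * Im (c * cnj b)"
    by (simp add: a'_def b'_def field_simps power2_eq_square)
  then show "0 < Im (b' * cnj a')" using assms by (simp add: add_nonneg_pos)
  have "Im (c * cnj a') = Im (c * cnj a) + l * Im (c * cnj b)"
    by (simp add: a'_def algebra_simps)
  then show "0 < Im (c * cnj a')" using assms by (simp add: add_pos_pos)
  have "Im (c * cnj b') = Im (c * cnj b)"
    by (simp add: b'_def algebra_simps)
  then show "0 < Im (c * cnj b')" using assms by simp
  \<comment> \<open>The position of \<open>x b\<close> relative to \<open>c\<close> is needed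
    because \<open>x a'\<close> contains the term \<open>l x b\<close>.\<close>
  have "Im (c * cnj a) * Im (x * b * cnj c) =
      Im (c * cnj b) * Im (x * a * cnj c) + Im (b * cnj a) * (cmod c)\<^sup>2 * Im x"
    unfolding cmod_power2 by (simp add: power2_eq_square algebra_simps)
  also have "\<dots> > 0" using assms by (intro add_pos_nonneg mult_pos_pos mult_nonneg_nonneg) auto
  finally have "0 < Im (x * b * cnj c)" using assms(2) by (simp add: zero_less_mult_iff)
  moreover have "Im (x * a' * cnj c) =
      Im (x * a * cnj c) + l * Im (x * b * cnj c) + l\<^sup>2 / 2 * (cmod c)\<^sup>2 * Im x"
    unfolding cmod_power2 by (simp add: a'_def algebra_simps power2_eq_square)
  ultimately show "0 < Im (x * a' * cnj c)"
    using assms by (simp add: add_pos_nonneg)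
qed

lemma cone_step_mass:
  fixes a b c x :: complex and m :: real
  assumes "0 \<le> Im (b * cnj a)" "0 < Im (c * cnj a)" "0 < Im (c * cnj b)"
    "0 < Im (x * a * cnj c)" "0 < Im x" "0 < m"
  defines "c' \<equiv> c + of_real m * x * a"
  shows "0 < Im (c' * cnj a)" "0 < Im (c' * cnj b)" "0 < Im (x * a * cnj c')"
proof -
  have "Im (c' * cnj a) = Im (c * cnj a) + m * (cmod a)\<^sup>2 * Im x"
    unfolding cmod_power2 by (simp add: c'_def algebra_simps power2_eq_square)
  then show "0 < Im (c' * cnj a)" using assms by (simp add: add_pos_nonneg)
  \<comment> \<open>As \<open>c'\<close> is \<open>c\<close> plus a positive multiple of
    \<open>x a\<close>, its position relative to \<open>b\<close> requires that of
    \<open>x a\<close>.\<close>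
  have "Im (c * cnj a) * Im (x * a * cnj b) =
      Im (c * cnj b) * (cmod a)\<^sup>2 * Im x + Im (b * cnj a) * Im (x * a * cnj c)"
    unfolding cmod_power2 by (simp add: power2_eq_square algebra_simps)
  also have "\<dots> \<ge> 0" using assms by (intro add_nonneg_nonneg mult_nonneg_nonneg) auto
  finally have "0 \<le> Im (x * a * cnj b)" using assms(2) by (simp add: zero_le_mult_iff)
  moreover have "Im (c' * cnj b) = Im (c * cnj b) + m * Im (x * a * cnj b)"
    by (simp add: c'_def algebra_simps)
  ultimately show "0 < Im (c' * cnj b)" using assms by (simp add: add_pos_nonneg)
  have "Im (x * a * cnj c') = Im (x * a * cnj c)"
    by (simp add: c'_def algebra_simps)
  then show "0 < Im (x * a * cnj c')" using assms by simp
qed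

section \<open>Real polynomials at complex arguments\<close>

abbreviation cpoly :: "real poly \<Rightarrow> complex \<Rightarrow> complex" where
  "cpoly p \<equiv> poly (map_poly complex_of_real p)"

lemma cpoly_of_real: "cpoly p (complex_of_real x) = complex_of_real (poly p x)"
  by (induction p) (simp_all add: map_poly_pCons)

lemma cpoly_simps [simp]:
  "cpoly (p + q) x = cpoly p x + cpoly q x"
  "cpoly (- p) x = - cpoly p x"
  "cpoly (Polynomial.smult a p) x = complex_of_real a * cpoly p x"
  "cpoly (p * q) x = cpoly p x * cpoly q x"
  "cpoly (pCons a p) x = complex_of_real a + x * cpoly p x"
  "cpoly 0 x = 0" "cpoly 1 x = 1"
proof -
  show add: "cpoly (p + q) x = cpoly p x + cpoly q x" for p q
    by (induction p q rule: poly_induct2) (simp_all add: map_poly_pCons algebra_simps)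
  show smult: "cpoly (Polynomial.smult a p) x = complex_of_real a * cpoly p x" for a p
    by (induction p) (simp_all add: map_poly_pCons algebra_simps)
  show "cpoly (- p) x = - cpoly p x"
    by (induction p) (simp_all add: map_poly_pCons)
  show pc: "cpoly (pCons a p) x = complex_of_real a + x * cpoly p x" for a p
    by (simp add: map_poly_pCons)
  show "cpoly (p * q) x = cpoly p x * cpoly q x"
    by (induction p) (simp_all add: add smult pc algebra_simps)
qed (simp_all)

lemma cpoly_sum [simp]: "cpoly (sum f A) x = (\<Sum>i\<in>A. cpoly (f i) x)"
  by (induction A rule: infinite_finite_induct) simp_all

lemma cpoly_power [simp]: "cpoly (p ^ n) x = cpoly p x ^ n"
  by (induction n) simp_all

lemma cpoly_cnj: "cpoly p (cnj x) = cnj (cpoly p x)"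
  by (induction p) (simp_all add: map_poly_pCons)

lemma pderiv_map_poly_of_real: "pderiv (map_poly complex_of_real p) = map_poly complex_of_real (pderiv p)"
  by (rule poly_eqI) (simp add: coeff_pderiv coeff_map_poly)

text \<open>
  Near a zero of order \<open>m\<close> of \<open>p\<close>, along the ray in direction \<open>w\<close>, the sign of the imaginary part is
  that of a real constant times \<open>Im (cnj (w ^ m))\<close>. For \<open>m \<ge> 2\<close> the power \<open>w ^ m\<close> attains both
  \<open>\<i>\<close> and \<open>- \<i>\<close> in the upper half plane.
\<close>

lemma nevanlinna_root:
  fixes p q :: "real poly" and x0 :: real
  assumes im: "\<And>x. 0 < Im x \<Longrightarrow> 0 \<le> Im (cpoly q x * cnj (cpoly p x))"
    and p: "p \<noteq> 0" "poly p x0 = 0" and q: "poly q x0 \<noteq> 0"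
  shows "poly (pderiv p) x0 \<noteq> 0" "poly q x0 / poly (pderiv p) x0 \<le> 0"
proof -
  define m where "m = Polynomial.order x0 p"
  have m: "m \<ge> 1" using p order_root[of p x0] by (simp add: m_def)
  obtain r where r: "p = [:- x0, 1:] ^ m * r" "\<not> [:- x0, 1:] dvd r"
    using order_decomp[OF p(1), of x0] unfolding m_def by blast
  then have r0: "poly r x0 \<noteq> 0" by (simp add: poly_eq_0_iff_dvd)
  have dir: "0 \<le> poly q x0 * poly r x0 * Im (cnj (w ^ m))" if w: "0 < Im w" for w
  proof -
    have "((\<lambda>e. Im (cpoly q (of_real x0 + of_real e * w) *
        cnj (w ^ m * cpoly r (of_real x0 + of_real e * w)))) \<longlongrightarrow>
        Im (cpoly q (of_real x0 + of_real 0 * w) * cnj (w ^ m * cpoly r (of_real x0 + of_real 0 * w))))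
        (at_right 0)"
      by (intro tendsto_intros)
    moreover have "\<forall>\<^sub>F e in at_right 0. 0 \<le> Im (cpoly q (of_real x0 + of_real e * w) *
        cnj (w ^ m * cpoly r (of_real x0 + of_real e * w)))"
      using eventually_at_right_less[of "0::real"]
    proof eventually_elim
      case (elim e)
      let ?x = "of_real x0 + of_real e * w"
      have "0 \<le> Im (cpoly q ?x * cnj (cpoly p ?x))"
        using elim w by (intro im) simp
      also have "cpoly p ?x = of_real (e ^ m) * (w ^ m * cpoly r ?x)"
        by (simp add: r(1) power_mult_distrib)
      also have "cpoly q ?x * cnj (of_real (e ^ m) * (w ^ m * cpoly r ?x)) =
          of_real (e ^ m) * (cpoly q ?x * cnj (w ^ m * cpoly r ?x))"
        by (simp add: mult_ac)
      also have "Im \<dots> = e ^ m * Im (cpoly q ?x * cnj (w ^ m * cpoly r ?x))"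
        by simp
      finally have "0 \<le> e ^ m * Im (cpoly q ?x * cnj (w ^ m * cpoly r ?x))" .
      moreover have "0 < e ^ m" using elim by simp
      ultimately show ?case by (metis zero_le_mult_iff not_less)
    qed
    ultimately have "0 \<le> Im (cpoly q (of_real x0 + of_real 0 * w) *
        cnj (w ^ m * cpoly r (of_real x0 + of_real 0 * w)))"
      by (rule tendsto_lowerbound) simp
    also have "\<dots> = poly q x0 * poly r x0 * Im (cnj (w ^ m))"
      by (simp add: cpoly_of_real)
    finally show ?thesis .
  qed
  have m1: "m = 1"
  proof (rule ccontr)
    assume "m \<noteq> 1"
    with m have m2: "m \<ge> 2" by simp
    \<comment> \<open>As \<open>m \<ge> 2\<close>, arguments below \<open>2 * pi\<close> shrink
      below \<open>pi\<close>, so the required \<open>m\<close>-th roots lie in the upper half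
      plane.\<close>
    have cis: "0 < Im (cis (t / m))" if "0 < t" "t < 2 * pi" for t
    proof -
      have "t / m < 2 * pi / m"
        using that m2 by (intro divide_strict_right_mono) auto
      also have "\<dots> \<le> 2 * pi / 2"
        using m2 by (intro divide_left_mono) auto
      finally have "t / m < pi" by simp
      moreover have "0 < t / m" using that m2 by simp
      ultimately have "0 < sin (t / m)" by (rule sin_gt_zero[rotated])
      then show ?thesis by simp
    qed
    have pw: "cis (t / m) ^ m = cis t" for t
      using m2 by (simp add: Complex.DeMoivre)
    have "0 \<le> poly q x0 * poly r x0 * - 1"
      using dir[OF cis[of "pi / 2"]] unfolding pw by simp
    moreover have "0 \<le> poly q x0 * poly r x0"
      using dir[OF cis[of "3 * pi / 2"]] sin_3over2_pi unfolding pw by simp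
    ultimately show False using q r0 by (simp add: mult_less_0_iff)
  qed
  have p1: "poly (pderiv p) x0 = poly r x0"
    unfolding r(1) m1 power_one_right pderiv_mult by (simp add: pderiv_pCons)
  then show "poly (pderiv p) x0 \<noteq> 0" using r0 by simp
  \<comment> \<open>For a simple zero the direction \<open>\<i>\<close> decides the sign, as
    \<open>Im (cnj \<i>) = - 1\<close>.\<close>
  have "poly q x0 * poly r x0 \<le> 0" using dir[of \<i>] by (simp add: m1)
  then show "poly q x0 / poly (pderiv p) x0 \<le> 0"
    by (simp add: p1 divide_le_0_iff mult_le_0_iff)
qed

lemma card_simple_roots:
  fixes p :: "complex poly"
  assumes "\<And>x. poly p x = 0 \<Longrightarrow> poly (pderiv p) x \<noteq> 0"
  shows "card {x. poly p x = 0} = degree p"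
proof -
  have p: "p \<noteq> 0" using assms by force
  have "rsquarefree p" using assms by (auto simp: rsquarefree_roots)
  then have "p = Polynomial.smult (lead_coeff p) (\<Prod>z|poly p z = 0. [:-z, 1:])"
    by (rule complex_poly_decompose_rsquarefree[symmetric])
  then have "degree p = degree (\<Prod>z|poly p z = 0. [:-z, 1:])"
    using p by (metis degree_smult_eq leading_coeff_0_iff)
  also have "\<dots> = card {x. poly p x = 0}"
    by (subst degree_prod_sum_eq) auto
  finally show ?thesis ..
qed

section \<open>Boundary values as polynomials in \<open>x = - z\<close>\<close>

text \<open>The recursion of \<open>mass_vec\<close> over the polynomial ring, in the variable
  \<open>x = - z\<close>; the change of sign removes the minus in front of the kernel.\<close>

definition mass_poly :: "(nat \<Rightarrow> real) \<Rightarrow> (nat \<Rightarrow> real) \<Rightarrow> nat \<Rightarrow> real poly" where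
  "mass_poly \<xi> g = forward_sol (\<lambda>i. [:(\<xi> i)\<^sup>2 / 2:]) (\<lambda>i j. [:0, g j * ((\<xi> i - \<xi> j)\<^sup>2 / 2):])"

text \<open>
  \<open>end_char n \<xi> g a\<close> is \<open>P\<^sub>a\<close> in the variable \<open>x = - z\<close>, in which all coefficients are nonnegative.
\<close>

definition end_char :: "nat \<Rightarrow> (nat \<Rightarrow> real) \<Rightarrow> (nat \<Rightarrow> real) \<Rightarrow> nat \<Rightarrow> real poly" where
  "end_char n \<xi> g a =
     pCons (end_kernel a 0) (\<Sum>j=1..n. Polynomial.smult (g j * end_kernel a (\<xi> j)) (mass_poly \<xi> g j))"

lemma mass_poly_rec:
  "mass_poly \<xi> g i = pCons ((\<xi> i)\<^sup>2 / 2)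
     (\<Sum>j\<in>{1..<i}. Polynomial.smult (g j * ((\<xi> i - \<xi> j)\<^sup>2 / 2)) (mass_poly \<xi> g j))"
proof -
  have "(\<Sum>j\<in>A. pCons 0 (h j)) = pCons 0 (\<Sum>j\<in>A. h j :: real poly)" for A :: "nat set" and h
    by (induction A rule: infinite_finite_induct) simp_all
  then show ?thesis
    unfolding mass_poly_def by (subst forward_sol.simps) simp
qed

lemma cpoly_mass_poly: "cpoly (mass_poly \<xi> g i) x = mass_vec \<xi> g (- x) i"
proof (induction i rule: less_induct)
  case (less i)
  have "(\<Sum>j\<in>{1..<i}. complex_of_real (g j * ((\<xi> i - \<xi> j)\<^sup>2 / 2)) * cpoly (mass_poly \<xi> g j) x) =
    (\<Sum>j\<in>{1..<i}. complex_of_real (g j * ((\<xi> i - \<xi> j)\<^sup>2 / 2)) * mass_vec \<xi> g (- x) j)"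
    by (rule sum.cong) (simp_all add: less.IH)
  then show ?case
    unfolding mass_poly_rec[of \<xi> g i] mass_vec_rec[of \<xi> g "- x" i]
    by (simp only: cpoly_simps cpoly_sum) simp
qed

context
  fixes n :: nat and \<xi> g :: "nat \<Rightarrow> real"
  assumes c: "cubic_string n \<xi> g"
begin

lemma cpoly_end_char: "a \<le> 2 \<Longrightarrow> cpoly (end_char n \<xi> g a) x = phi_end n \<xi> g a (- x)"
  unfolding end_char_def phi_end_eq[OF c] by (simp only: cpoly_simps cpoly_sum cpoly_mass_poly) simp

lemma g_pos: "i \<in> {1..n} \<Longrightarrow> 0 < g i"
  using c by (simp add: cubic_string_def)

lemma end_kernel_pos: "t < 1 \<Longrightarrow> 0 < end_kernel a t"
  by (simp add: end_kernel_def)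

lemma mass_poly_nonneg:
  assumes "0 \<le> x" "i \<in> {1..n}"
  shows "0 \<le> poly (mass_poly \<xi> g i) x"
  using assms(2)
proof (induction i rule: less_induct)
  case (less i)
  have "0 \<le> (\<Sum>j\<in>{1..<i}. g j * ((\<xi> i - \<xi> j)\<^sup>2 / 2) * poly (mass_poly \<xi> g j) x)"
    using less g_pos by (intro sum_nonneg mult_nonneg_nonneg) (auto intro: less_imp_le)
  then show ?case
    using assms(1) by (subst mass_poly_rec) (simp add: poly_sum)
qed

text \<open>Excludes roots \<open>x \<ge> 0\<close>, so that real spectral points
  \<open>z = - x\<close> are positive.\<close>

lemma end_char_pos:
  assumes "0 \<le> x"
  shows "0 < poly (end_char n \<xi> g a) x"
proof -
  have "0 \<le> (\<Sum>j=1..n. g j * end_kernel a (\<xi> j) * poly (mass_poly \<xi> g j) x)"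
    using mass_poly_nonneg[OF assms] g_pos mass_point_in_interval[OF c]
    by (intro sum_nonneg mult_nonneg_nonneg) (auto intro!: less_imp_le end_kernel_pos)
  then show ?thesis
    using assms end_kernel_pos[of 0 a] by (simp add: end_char_def poly_sum add_pos_nonneg)
qed

text \<open>Each recursion step raises the degree by one. Only the chain through all masses before
  \<open>i\<close> reaches degree \<open>i - 1\<close>, so the leading coefficient comes from the
  single summand \<open>j = i - 1\<close> and is positive.\<close>

lemma mass_poly_degree:
  assumes "i \<in> {1..n}"
  shows "degree (mass_poly \<xi> g i) \<le> i - 1 \<and> 0 < coeff (mass_poly \<xi> g i) (i - 1)"
  using assms
proof (induction i rule: less_induct)
  case (less i)
  define S where "S = (\<Sum>j\<in>{1..<i}. Polynomial.smult (g j * ((\<xi> i - \<xi> j)\<^sup>2 / 2)) (mass_poly \<xi> g j))"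
  have rec: "mass_poly \<xi> g i = pCons ((\<xi> i)\<^sup>2 / 2) S"
    unfolding S_def by (rule mass_poly_rec)
  show ?case
  proof (cases "i = 1")
    case True
    then show ?thesis
      using rec mass_point_in_interval[OF c less.prems] by (simp add: S_def)
  next
    case False
    then have i: "2 \<le> i" using less.prems by simp
    have "degree S \<le> i - 2"
      unfolding S_def
    proof (rule degree_sum_le)
      fix j assume j: "j \<in> {1..<i}"
      have "degree (mass_poly \<xi> g j) \<le> j - 1" using less j by auto
      also have "\<dots> \<le> i - 2" using j by auto
      finally show "degree (Polynomial.smult (g j * ((\<xi> i - \<xi> j)\<^sup>2 / 2)) (mass_poly \<xi> g j)) \<le> i - 2"
        using degree_smult_le order_trans by blast
    qed simp
    moreover have "0 < coeff S (i - 2)"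
    proof -
      have "coeff S (i - 2) =
          (\<Sum>j\<in>{1..<i}. g j * ((\<xi> i - \<xi> j)\<^sup>2 / 2) * coeff (mass_poly \<xi> g j) (i - 2))"
        by (simp add: S_def coeff_sum)
      also have "\<dots> = (\<Sum>j\<in>{i - 1}. g j * ((\<xi> i - \<xi> j)\<^sup>2 / 2) * coeff (mass_poly \<xi> g j) (i - 2))"
      proof (rule sum.mono_neutral_right)
        show "\<forall>j\<in>{1..<i} - {i - 1}.
            g j * ((\<xi> i - \<xi> j)\<^sup>2 / 2) * coeff (mass_poly \<xi> g j) (i - 2) = 0"
        proof
          fix j assume j: "j \<in> {1..<i} - {i - 1}"
          have "degree (mass_poly \<xi> g j) \<le> j - 1" using less j by auto
          also have "\<dots> < i - 2" using j by auto
          finally show "g j * ((\<xi> i - \<xi> j)\<^sup>2 / 2) * coeff (mass_poly \<xi> g j) (i - 2) = 0"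
            by (simp add: coeff_eq_0)
        qed
      qed (use i in auto)
      also have "\<dots> > 0"
      proof -
        have i1: "i - 1 \<in> {1..n}" using i less.prems by auto
        have "\<xi> (i - 1) < \<xi> i" using mass_points_ordered(1)[OF c i1 less.prems] i by simp
        then show ?thesis
          using less.IH[of "i - 1"] g_pos[OF i1] i1 i by (simp add: numeral_2_eq_2)
      qed
      finally show ?thesis .
    qed
    moreover have "i - 1 = Suc (i - 2)" using i by simp
    ultimately show ?thesis
      unfolding rec by (simp add: degree_pCons_le order_trans[OF degree_pCons_le])
  qed
qed

lemma degree_end_char: "degree (end_char n \<xi> g a) = n"
proof (rule antisym)
  have n: "1 \<le> n" using c by (simp add: cubic_string_def)
  define S where "S = (\<Sum>j=1..n. Polynomial.smult (g j * end_kernel a (\<xi> j)) (mass_poly \<xi> g j))"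
  have E: "end_char n \<xi> g a = pCons (end_kernel a 0) S" by (simp add: end_char_def S_def)
  have "degree S \<le> n - 1"
    unfolding S_def
  proof (rule degree_sum_le)
    fix j assume j: "j \<in> {1..n}"
    have "degree (mass_poly \<xi> g j) \<le> j - 1" using mass_poly_degree[OF j] by simp
    also have "\<dots> \<le> n - 1" using j by auto
    finally show "degree (Polynomial.smult (g j * end_kernel a (\<xi> j)) (mass_poly \<xi> g j)) \<le> n - 1"
      using degree_smult_le order_trans by blast
  qed simp
  then have "degree (end_char n \<xi> g a) \<le> Suc (n - 1)"
    unfolding E by (meson Suc_le_mono degree_pCons_le order_trans)
  then show "degree (end_char n \<xi> g a) \<le> n" using n by simp
  have "coeff S (n - 1) =
      (\<Sum>j=1..n. g j * end_kernel a (\<xi> j) * coeff (mass_poly \<xi> g j) (n - 1))"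
    by (simp add: S_def coeff_sum)
  also have "\<dots> = (\<Sum>j\<in>{n}. g j * end_kernel a (\<xi> j) * coeff (mass_poly \<xi> g j) (n - 1))"
  proof (rule sum.mono_neutral_right)
    show "\<forall>j\<in>{1..n} - {n}. g j * end_kernel a (\<xi> j) * coeff (mass_poly \<xi> g j) (n - 1) = 0"
    proof
      fix j assume j: "j \<in> {1..n} - {n}"
      have "degree (mass_poly \<xi> g j) \<le> j - 1" using mass_poly_degree j by auto
      also have "\<dots> < n - 1" using j by auto
      finally show "g j * end_kernel a (\<xi> j) * coeff (mass_poly \<xi> g j) (n - 1) = 0"
        by (simp add: coeff_eq_0)
    qed
  qed (use n in auto)
  also have "\<dots> > 0"
    using mass_poly_degree[of n] g_pos[of n] end_kernel_pos mass_point_in_interval[OF c, of n] n by simp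
  finally have "coeff (end_char n \<xi> g a) (Suc (n - 1)) \<noteq> 0" by (simp add: E)
  then show "n \<le> degree (end_char n \<xi> g a)" using n le_degree by fastforce
qed

text \<open>
  The values at \<open>t\<close> of \<open>\<phi>\<close>, \<open>\<phi>'\<close>, \<open>\<phi>''\<close> for \<open>z = - x\<close> when only the first \<open>k\<close> masses are present.
\<close>

definition state0 :: "complex \<Rightarrow> nat \<Rightarrow> real \<Rightarrow> complex" where
  "state0 x k t = of_real (t\<^sup>2 / 2) +
     x * (\<Sum>j=1..k. complex_of_real (g j * ((t - \<xi> j)\<^sup>2 / 2)) * mass_vec \<xi> g (- x) j)"

definition state1 :: "complex \<Rightarrow> nat \<Rightarrow> real \<Rightarrow> complex" where
  "state1 x k t = of_real t +
     x * (\<Sum>j=1..k. complex_of_real (g j * (t - \<xi> j)) * mass_vec \<xi> g (- x) j)"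

definition state2 :: "complex \<Rightarrow> nat \<Rightarrow> complex" where
  "state2 x k = 1 + x * (\<Sum>j=1..k. complex_of_real (g j) * mass_vec \<xi> g (- x) j)"

text \<open>Termwise Taylor expansion of the kernels, quadratic and linear in \<open>t\<close>. On a
  mass-free interval this is the map of \<open>cone_step_free\<close>.\<close>

lemma state_shift:
  "state0 x k t = state0 x k s + of_real (t - s) * state1 x k s + of_real ((t - s)\<^sup>2 / 2) * state2 x k"
  "state1 x k t = state1 x k s + of_real (t - s) * state2 x k"
proof -
  let ?f = "mass_vec \<xi> g (- x)"
  define SA SB SC where "SA s = (\<Sum>j=1..k. complex_of_real (g j * ((s - \<xi> j)\<^sup>2 / 2)) * ?f j)"
    and "SB s = (\<Sum>j=1..k. complex_of_real (g j * (s - \<xi> j)) * ?f j)"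
    and "SC = (\<Sum>j=1..k. complex_of_real (g j) * ?f j)" for s
  have "SA t = (\<Sum>j=1..k. complex_of_real (g j * ((s - \<xi> j)\<^sup>2 / 2)) * ?f j +
      of_real (t - s) * (complex_of_real (g j * (s - \<xi> j)) * ?f j) +
      of_real ((t - s)\<^sup>2 / 2) * (complex_of_real (g j) * ?f j))"
    unfolding SA_def by (rule sum.cong) (simp_all add: power2_eq_square field_simps)
  then have 1: "SA t = SA s + of_real (t - s) * SB s + of_real ((t - s)\<^sup>2 / 2) * SC"
    unfolding SA_def SB_def SC_def sum.distrib sum_distrib_left .
  have "SB t = (\<Sum>j=1..k. complex_of_real (g j * (s - \<xi> j)) * ?f j +
      of_real (t - s) * (complex_of_real (g j) * ?f j))"
    unfolding SB_def by (rule sum.cong) (simp_all add: field_simps)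
  then have 2: "SB t = SB s + of_real (t - s) * SC"
    unfolding SB_def SC_def sum.distrib sum_distrib_left .
  show "state0 x k t = state0 x k s + of_real (t - s) * state1 x k s + of_real ((t - s)\<^sup>2 / 2) * state2 x k"
    unfolding state0_def state1_def state2_def SA_def[symmetric] SB_def[symmetric] SC_def[symmetric] 1
    by (simp add: power2_eq_square field_simps)
  show "state1 x k t = state1 x k s + of_real (t - s) * state2 x k"
    unfolding state1_def state2_def SB_def[symmetric] SC_def[symmetric] 2
    by (simp add: field_simps)
qed

text \<open>The kernel of the new mass vanishes together with its slope at its own position, so only
  the second derivative changes, as in \<open>cone_step_mass\<close>.\<close>

lemma state_mass:
  "state0 x (Suc k) (\<xi> (Suc k)) = state0 x k (\<xi> (Suc k))"
  "state1 x (Suc k) (\<xi> (Suc k)) = state1 x k (\<xi> (Suc k))"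
  "state2 x (Suc k) = state2 x k + of_real (g (Suc k)) * x * state0 x k (\<xi> (Suc k))"
proof -
  have "mass_vec \<xi> g (- x) (Suc k) = state0 x k (\<xi> (Suc k))"
    unfolding mass_vec_rec[of \<xi> g "- x" "Suc k"] state0_def by (simp add: atLeastLessThanSuc_atLeastAtMost)
  then show "state0 x (Suc k) (\<xi> (Suc k)) = state0 x k (\<xi> (Suc k))"
    "state1 x (Suc k) (\<xi> (Suc k)) = state1 x k (\<xi> (Suc k))"
    "state2 x (Suc k) = state2 x k + of_real (g (Suc k)) * x * state0 x k (\<xi> (Suc k))"
    by (simp_all add: state0_def state1_def state2_def algebra_simps)
qed

lemma state_end:
  "state0 x n 1 = cpoly (end_char n \<xi> g 0) x"
  "state1 x n 1 = cpoly (end_char n \<xi> g 1) x"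
  "state2 x n = cpoly (end_char n \<xi> g 2) x"
  by (simp_all add: cpoly_end_char phi_end_eq[OF c] state0_def state1_def state2_def end_kernel_def)

section \<open>Argument ordering of the states and location of the zeros\<close>

text \<open>Each induction step is a free step to the next mass followed by a mass step. The start
  is the first mass, because the initial state \<open>(0, 0, 1)\<close> violates the strict
  inequalities.\<close>

lemma cone_after_mass:
  assumes x: "0 < Im x" and k: "1 \<le> k" "k \<le> n"
  shows "0 \<le> Im (state1 x k (\<xi> k) * cnj (state0 x k (\<xi> k))) \<and> 0 < Im (state2 x k * cnj (state0 x k (\<xi> k))) \<and>
    0 < Im (state2 x k * cnj (state1 x k (\<xi> k))) \<and> 0 < Im (x * state0 x k (\<xi> k) * cnj (state2 x k))"
  using k
proof (induction k rule: nat_induct_at_least)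
  case base
  have 1: "0 < \<xi> 1" "0 < g 1"
    using mass_point_in_interval[OF c, of 1] g_pos[of 1] base by simp_all
  \<comment> \<open>The first two components are still real here, so the first inequality holds only
    with equality; this is why it is kept weak.\<close>
  have st: "state0 x 1 (\<xi> 1) = of_real ((\<xi> 1)\<^sup>2 / 2)" "state1 x 1 (\<xi> 1) = of_real (\<xi> 1)"
    "state2 x 1 = 1 + of_real (g 1 * ((\<xi> 1)\<^sup>2 / 2)) * x"
    using state_mass[of x 0] by (simp_all add: state0_def state1_def state2_def)
  then show ?case
    unfolding st using 1 x by simp
next
  case (Suc k)
  then have IH: "0 \<le> Im (state1 x k (\<xi> k) * cnj (state0 x k (\<xi> k)))" "0 < Im (state2 x k * cnj (state0 x k (\<xi> k)))"
    "0 < Im (state2 x k * cnj (state1 x k (\<xi> k)))" "0 < Im (x * state0 x k (\<xi> k) * cnj (state2 x k))"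
    by simp_all
  have l: "0 < \<xi> (Suc k) - \<xi> k"
    using mass_points_ordered(1)[OF c, of k "Suc k"] Suc by simp
  have m: "0 < g (Suc k)" using g_pos Suc by simp
  note free = cone_step_free[OF IH x l, folded state_shift]
  show ?case
    unfolding state_mass
    using cone_step_mass[OF less_imp_le[OF free(1)] free(2-4) x m] free(1) by simp
qed

text \<open>The free step from the last mass to 1 also makes the first inequality strict.\<close>

lemma cone_end:
  assumes x: "0 < Im x"
  shows "0 < Im (cpoly (end_char n \<xi> g 1) x * cnj (cpoly (end_char n \<xi> g 0) x))"
    "0 < Im (cpoly (end_char n \<xi> g 2) x * cnj (cpoly (end_char n \<xi> g 0) x))"
    "0 < Im (cpoly (end_char n \<xi> g 2) x * cnj (cpoly (end_char n \<xi> g 1) x))"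
proof -
  have n: "1 \<le> n" using c by (simp add: cubic_string_def)
  have l: "0 < 1 - \<xi> n" using mass_point_in_interval[OF c, of n] n by simp
  note inv = cone_after_mass[OF x n order_refl]
  note free = cone_step_free[OF conjunct1[OF inv] conjunct1[OF conjunct2[OF inv]]
      conjunct1[OF conjunct2[OF conjunct2[OF inv]]] conjunct2[OF conjunct2[OF conjunct2[OF inv]]] x l,
      folded state_shift, unfolded state_end]
  show "0 < Im (cpoly (end_char n \<xi> g 1) x * cnj (cpoly (end_char n \<xi> g 0) x))"
    "0 < Im (cpoly (end_char n \<xi> g 2) x * cnj (cpoly (end_char n \<xi> g 0) x))"
    "0 < Im (cpoly (end_char n \<xi> g 2) x * cnj (cpoly (end_char n \<xi> g 1) x))"
    by (fact free)+
qed

text \<open>The transfer maps of the state are invertible, and the initial state is nonzero.\<close>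

lemma end_state_nonzero: "\<not> (cpoly (end_char n \<xi> g 0) x = 0 \<and> cpoly (end_char n \<xi> g 1) x = 0 \<and> cpoly (end_char n \<xi> g 2) x = 0)"
proof
  assume *: "cpoly (end_char n \<xi> g 0) x = 0 \<and> cpoly (end_char n \<xi> g 1) x = 0 \<and> cpoly (end_char n \<xi> g 2) x = 0"
  have "state0 x k t = 0 \<and> state1 x k t = 0 \<and> state2 x k = 0" if "k \<le> n" for k t
    using that
  proof (induction k arbitrary: t rule: inc_induct)
    case base
    then show ?case using * state_shift[of x n t 1] by (simp add: state_end)
  next
    case (step k)
    then have "state0 x k (\<xi> (Suc k)) = 0" "state1 x k (\<xi> (Suc k)) = 0" "state2 x k = 0"
      using state_mass[of x k] by (metis add_cancel_left_right add_0_right mult_zero_right)+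
    then show ?case using state_shift[of x k t "\<xi> (Suc k)"] by simp
  qed
  from this[of 0 0] show False by (simp add: state2_def)
qed

text \<open>A strict inequality of \<open>cone_end\<close> involving
  \<open>end_char n \<xi> g a\<close> excludes the upper half plane, complex conjugation the lower
  one, and positivity of \<open>end_char\<close> the half line \<open>x \<ge> 0\<close>.\<close>

lemma end_char_root_real:
  assumes "a \<le> 2" "cpoly (end_char n \<xi> g a) x = 0"
  obtains t where "x = complex_of_real t" "t < 0" "poly (end_char n \<xi> g a) t = 0"
proof -
  have upper: "cpoly (end_char n \<xi> g a) y \<noteq> 0" if "0 < Im y" for y
  proof -
    consider "a = 0" | "a = 1" | "a = 2" using assms by linarith
    then show ?thesis
      using cone_end[OF that] by cases auto
  qed
  have "cpoly (end_char n \<xi> g a) (cnj x) = 0" using assms(2) by (simp add: cpoly_cnj)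
  then have "Im x = 0"
    using upper[of x] upper[of "cnj x"] assms(2) by force
  then obtain t where t: "x = complex_of_real t" by (metis complex_is_Real_iff Reals_cases)
  then have "poly (end_char n \<xi> g a) t = 0" using assms(2) by (simp add: cpoly_of_real)
  moreover from this have "t < 0" using end_char_pos[of t a] by (cases "t < 0") auto
  ultimately show ?thesis using that t by simp
qed

lemma end_char_ne0: "end_char n \<xi> g a \<noteq> 0"
  using end_char_pos[of 0 a] by auto

text \<open>\<open>nevanlinna_root\<close> is applied to each ordered pair of boundary values. It
  needs a nonzero numerator at the root; otherwise the quotient is 0 and the sign claim is
  trivial.\<close>

lemma end_char_quotient_signs:
  "poly (end_char n \<xi> g 0) t = 0 \<Longrightarrow> poly (end_char n \<xi> g 1) t / poly (pderiv (end_char n \<xi> g 0)) t \<le> 0"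
  "poly (end_char n \<xi> g 0) t = 0 \<Longrightarrow> poly (end_char n \<xi> g 2) t / poly (pderiv (end_char n \<xi> g 0)) t \<le> 0"
  "poly (end_char n \<xi> g 1) t = 0 \<Longrightarrow> poly (end_char n \<xi> g 2) t / poly (pderiv (end_char n \<xi> g 1)) t \<le> 0"
  "poly (end_char n \<xi> g 1) t = 0 \<Longrightarrow> 0 \<le> poly (end_char n \<xi> g 0) t / poly (pderiv (end_char n \<xi> g 1)) t"
  "poly (end_char n \<xi> g 2) t = 0 \<Longrightarrow> 0 \<le> poly (end_char n \<xi> g 0) t / poly (pderiv (end_char n \<xi> g 2)) t"
  "poly (end_char n \<xi> g 2) t = 0 \<Longrightarrow> 0 \<le> poly (end_char n \<xi> g 1) t / poly (pderiv (end_char n \<xi> g 2)) t"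
  and end_char_simple_root: "\<lbrakk>a \<le> 2; poly (end_char n \<xi> g a) t = 0\<rbrakk> \<Longrightarrow> poly (pderiv (end_char n \<xi> g a)) t \<noteq> 0"
proof -
  \<comment> \<open>Exchanging numerator and denominator reverses the sign of the imaginary part;
    negating one polynomial restores it, which accounts for the opposite signs in the last three
    quotients.\<close>
  have flip: "Im (- u * cnj v) = Im (v * cnj u)" for u v by simp
  have im: "0 \<le> Im (cpoly (end_char n \<xi> g 1) x * cnj (cpoly (end_char n \<xi> g 0) x))"
    "0 \<le> Im (cpoly (end_char n \<xi> g 2) x * cnj (cpoly (end_char n \<xi> g 0) x))"
    "0 \<le> Im (cpoly (end_char n \<xi> g 2) x * cnj (cpoly (end_char n \<xi> g 1) x))"
    "0 \<le> Im (cpoly (- end_char n \<xi> g 0) x * cnj (cpoly (end_char n \<xi> g 1) x))"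
    "0 \<le> Im (cpoly (- end_char n \<xi> g 0) x * cnj (cpoly (end_char n \<xi> g 2) x))"
    "0 \<le> Im (cpoly (- end_char n \<xi> g 1) x * cnj (cpoly (end_char n \<xi> g 2) x))"
    if "0 < Im x" for x
    using cone_end[OF that] unfolding cpoly_simps flip by simp_all
  \<comment> \<open>Provides, at a root of one boundary value, another one that is nonzero and can
    serve as numerator in the proof of simplicity.\<close>
  have nz: "poly (end_char n \<xi> g 0) t \<noteq> 0 \<or> poly (end_char n \<xi> g 1) t \<noteq> 0 \<or> poly (end_char n \<xi> g 2) t \<noteq> 0"
    using end_state_nonzero[of "of_real t"] by (auto simp: cpoly_of_real)
  note N = nevanlinna_root[OF im(1) end_char_ne0] nevanlinna_root[OF im(2) end_char_ne0]
    nevanlinna_root[OF im(3) end_char_ne0] nevanlinna_root[OF im(4) end_char_ne0]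
    nevanlinna_root[OF im(5) end_char_ne0] nevanlinna_root[OF im(6) end_char_ne0]
  show "poly (end_char n \<xi> g 0) t = 0 \<Longrightarrow> poly (end_char n \<xi> g 1) t / poly (pderiv (end_char n \<xi> g 0)) t \<le> 0"
    using N(2)[of t] by (cases "poly (end_char n \<xi> g 1) t = 0") auto
  show "poly (end_char n \<xi> g 0) t = 0 \<Longrightarrow> poly (end_char n \<xi> g 2) t / poly (pderiv (end_char n \<xi> g 0)) t \<le> 0"
    using N(4)[of t] by (cases "poly (end_char n \<xi> g 2) t = 0") auto
  show "poly (end_char n \<xi> g 1) t = 0 \<Longrightarrow> poly (end_char n \<xi> g 2) t / poly (pderiv (end_char n \<xi> g 1)) t \<le> 0"
    using N(6)[of t] by (cases "poly (end_char n \<xi> g 2) t = 0") auto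
  show "poly (end_char n \<xi> g 1) t = 0 \<Longrightarrow> 0 \<le> poly (end_char n \<xi> g 0) t / poly (pderiv (end_char n \<xi> g 1)) t"
    using N(8)[of t] by (cases "poly (end_char n \<xi> g 0) t = 0") auto
  show "poly (end_char n \<xi> g 2) t = 0 \<Longrightarrow> 0 \<le> poly (end_char n \<xi> g 0) t / poly (pderiv (end_char n \<xi> g 2)) t"
    using N(10)[of t] by (cases "poly (end_char n \<xi> g 0) t = 0") auto
  show "poly (end_char n \<xi> g 2) t = 0 \<Longrightarrow> 0 \<le> poly (end_char n \<xi> g 1) t / poly (pderiv (end_char n \<xi> g 2)) t"
    using N(12)[of t] by (cases "poly (end_char n \<xi> g 1) t = 0") auto
  assume a: "a \<le> 2" "poly (end_char n \<xi> g a) t = 0"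
  consider "a = 0" | "a = 1" | "a = 2" using a by linarith
  then show "poly (pderiv (end_char n \<xi> g a)) t \<noteq> 0"
    using nz a(2) N(1,3,5,7,9,11)[of t] by cases auto
qed

text \<open>All roots are simple and the degree is \<open>n\<close>. The exact count is what later
  makes the matrices of eigenvectors square.\<close>

lemma card_spectrum:
  assumes "a \<le> 2"
  shows "card (spectrum n \<xi> g a) = n"
proof -
  have "spectrum n \<xi> g a = uminus ` {x. cpoly (end_char n \<xi> g a) x = 0}"
    using assms by (auto simp: spectrum_def cpoly_end_char image_iff intro!: exI[of _ "- _"])
  then have "card (spectrum n \<xi> g a) = card {x. cpoly (end_char n \<xi> g a) x = 0}"
    by (simp add: card_image)
  also have "\<dots> = degree (map_poly complex_of_real (end_char n \<xi> g a))"
  proof (rule card_simple_roots)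
    fix x assume "cpoly (end_char n \<xi> g a) x = 0"
    then obtain t where "x = complex_of_real t" "poly (end_char n \<xi> g a) t = 0"
      using end_char_root_real[OF assms] by blast
    then show "poly (pderiv (map_poly complex_of_real (end_char n \<xi> g a))) x \<noteq> 0"
      using end_char_simple_root[OF assms, of t]
      by (simp add: pderiv_map_poly_of_real cpoly_of_real)
  qed
  also have "\<dots> = n" using degree_end_char by (simp add: degree_map_poly)
  finally show ?thesis .
qed

lemma phi_end_has_derivative:
  assumes "a \<le> 2"
  shows "(phi_end n \<xi> g a has_field_derivative - cpoly (pderiv (end_char n \<xi> g a)) (- z)) (at z)"
proof -
  have "((\<lambda>z. cpoly (end_char n \<xi> g a) (- z)) has_field_derivative
      poly (pderiv (map_poly complex_of_real (end_char n \<xi> g a))) (- z) * - 1) (at z)"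
    by (rule DERIV_chain2[OF poly_DERIV]) (auto intro!: derivative_eq_intros)
  moreover have "phi_end n \<xi> g a = (\<lambda>z. cpoly (end_char n \<xi> g a) (- z))"
    using cpoly_end_char[OF assms] by auto
  ultimately show ?thesis by (simp add: pderiv_map_poly_of_real)
qed

lemmas deriv_phi_end = DERIV_imp_deriv[OF phi_end_has_derivative]

end

section \<open>Eigenfunction expansion and Parseval identity\<close>

text \<open>Green function of the third derivative with zero data at the left end, restricted to the
  masses; its transpose belongs to the adjoint problem.\<close>

definition causal_kernel :: "(nat \<Rightarrow> real) \<Rightarrow> nat \<Rightarrow> nat \<Rightarrow> complex" where
  "causal_kernel \<xi> i j = (if j < i then complex_of_real ((\<xi> i - \<xi> j)\<^sup>2 / 2) else 0)"

text \<open>Absorbs the sign in \<open>fourier\<close>; it cancels the sign of the terminal data,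
  leaving \<open>end_kernel a\<close> as inhomogeneity.\<close>

definition dual_vec :: "nat \<Rightarrow> (nat \<Rightarrow> real) \<Rightarrow> (nat \<Rightarrow> real) \<Rightarrow> nat \<Rightarrow> complex \<Rightarrow> nat \<Rightarrow> complex" where
  "dual_vec n \<xi> g a z i = (- 1) ^ a * star_vec n \<xi> g a z i"

text \<open>The inhomogeneity is written through \<open>1 - \<xi> i\<close>, the distance to the
  right end, to fit \<open>concomitant_self\<close>.\<close>

lemma mass_vec_causal_kernel:
  assumes "i \<in> {1..n}"
  shows "mass_vec \<xi> g z i = (1 - (1 - complex_of_real (\<xi> i)))\<^sup>2 / 2 -
     z * (\<Sum>j\<in>{1..n}. causal_kernel \<xi> i j * (complex_of_real (g j) * mass_vec \<xi> g z j))"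
proof -
  have "(\<Sum>j\<in>{1..n}. causal_kernel \<xi> i j * (complex_of_real (g j) * mass_vec \<xi> g z j)) =
    (\<Sum>j\<in>{1..<i}. complex_of_real (g j * ((\<xi> i - \<xi> j)\<^sup>2 / 2)) * mass_vec \<xi> g z j)"
    using assms by (intro sum.mono_neutral_cong_right) (auto simp: causal_kernel_def)
  then show ?thesis using mass_vec_rec[of \<xi> g z i] by simp
qed

lemma dual_vec_causal_kernel:
  assumes "i \<in> {1..n}"
  shows "dual_vec n \<xi> g a z i = complex_of_real (end_kernel a (\<xi> i)) -
     z * (\<Sum>j\<in>{1..n}. causal_kernel \<xi> j i * (complex_of_real (g j) * dual_vec n \<xi> g a z j))"
proof -
  have "(\<Sum>j\<in>{1..n}. causal_kernel \<xi> j i * (complex_of_real (g j) * dual_vec n \<xi> g a z j)) =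
    (\<Sum>j\<in>{i<..n}. complex_of_real (g j * ((\<xi> j - \<xi> i)\<^sup>2 / 2)) * dual_vec n \<xi> g a z j)"
    using assms by (intro sum.mono_neutral_cong_right) (auto simp: causal_kernel_def)
  also have "\<dots> = (- 1) ^ a *
    (\<Sum>j\<in>{i<..n}. complex_of_real (g j * ((\<xi> j - \<xi> i)\<^sup>2 / 2)) * star_vec n \<xi> g a z j)"
    by (simp only: dual_vec_def sum_distrib_left mult_ac)
  finally have *: "(\<Sum>j\<in>{1..n}. causal_kernel \<xi> j i * (complex_of_real (g j) * dual_vec n \<xi> g a z j)) =
    (- 1) ^ a *
    (\<Sum>j\<in>{i<..n}. complex_of_real (g j * ((\<xi> j - \<xi> i)\<^sup>2 / 2)) * star_vec n \<xi> g a z j)" .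
  have "dual_vec n \<xi> g a z i = (- 1) ^ a * ((- 1) ^ a * complex_of_real (end_kernel a (\<xi> i)) -
    z * (\<Sum>j\<in>{i<..n}. complex_of_real (g j * ((\<xi> j - \<xi> i)\<^sup>2 / 2)) * star_vec n \<xi> g a z j))"
    unfolding dual_vec_def by (subst star_vec_rec) simp
  also have "\<dots> = ((- 1) ^ a * (- 1) ^ a) * complex_of_real (end_kernel a (\<xi> i)) - z * ((- 1) ^ a *
    (\<Sum>j\<in>{i<..n}. complex_of_real (g j * ((\<xi> j - \<xi> i)\<^sup>2 / 2)) * star_vec n \<xi> g a z j))"
    by (simp only: right_diff_distrib mult_ac)
  finally show ?thesis
    unfolding * by (simp flip: power_mult_distrib)
qed

lemma isCont_dual_vec: "isCont (\<lambda>z. dual_vec n \<xi> g a z i) z"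
proof -
  have "isCont (\<lambda>z. star_vec n \<xi> g a z i) z"
  proof (induction "n - i" arbitrary: i rule: less_induct)
    case (less i)
    then show ?case
      by (subst star_vec_rec) (auto intro!: continuous_intros)
  qed
  then show ?thesis unfolding dual_vec_def by (intro continuous_intros)
qed

lemma isCont_mass_vec: "isCont (\<lambda>z. mass_vec \<xi> g z i) z"
proof -
  have "isCont (\<lambda>z. cpoly (mass_poly \<xi> g i) (- z)) z" by (intro continuous_intros)
  then show ?thesis by (simp add: cpoly_mass_poly)
qed

context
  fixes n :: nat and \<xi> g :: "nat \<Rightarrow> real"
  assumes c: "cubic_string n \<xi> g"
begin

lemma fourier_eq:
  assumes "a \<le> 2"
  shows "fourier n \<xi> g a f z = (\<Sum>i=1..n. complex_of_real (g i) * dual_vec n \<xi> g a z i * f (\<xi> i))"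
  unfolding fourier_def inner_g_def dual_vec_def sum_distrib_left
  by (rule sum.cong) (simp_all add: phi_star_mass[OF c assms] mult_ac)

lemma fourier_continuous:
  assumes "a \<le> 2"
  shows "continuous_on UNIV (\<lambda>x. fourier n \<xi> g a f (complex_of_real x))"
proof -
  have "continuous_on UNIV (\<lambda>x::real. dual_vec n \<xi> g a (complex_of_real x) i)" for i
    by (rule continuous_on_compose2[of UNIV "\<lambda>z. dual_vec n \<xi> g a z i"])
      (auto intro!: continuous_at_imp_continuous_on isCont_dual_vec continuous_intros)
  then show ?thesis
    unfolding fourier_eq[OF assms] by (intro continuous_intros)
qed

lemma phi_dual_pairing:
  assumes "a \<le> 2"
  shows "(z - w) * (\<Sum>i=1..n. complex_of_real (g i) * mass_vec \<xi> g z i * dual_vec n \<xi> g a w i) =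
    phi_end n \<xi> g a w - phi_end n \<xi> g a z"
proof -
  let ?G = "\<lambda>i. complex_of_real (g i)" and ?q = "\<lambda>i. complex_of_real (end_kernel a (\<xi> i))"
    and ?v = "\<lambda>i. (1 - (1 - complex_of_real (\<xi> i)))\<^sup>2 / 2"
  have *: "(z - w) * (\<Sum>i=1..n. ?G i * mass_vec \<xi> g z i * dual_vec n \<xi> g a w i) =
      z * (\<Sum>i=1..n. ?G i * ?q i * mass_vec \<xi> g z i) - w * (\<Sum>i=1..n. ?G i * ?v i * dual_vec n \<xi> g a w i)"
    for z w
    by (rule concomitant_adjoint[where K="causal_kernel \<xi>"]) (fact mass_vec_causal_kernel dual_vec_causal_kernel)+
  \<comment> \<open>At \<open>z = w\<close> the left side of the identity vanishes, which trades the
    boundary sum of the dual vector for that of \<phi> at \<open>w\<close>.\<close>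
  have "w * (\<Sum>i=1..n. ?G i * ?v i * dual_vec n \<xi> g a w i) = w * (\<Sum>i=1..n. ?G i * ?q i * mass_vec \<xi> g w i)"
    using *[of w w] by (simp only: diff_self mult_zero_left right_minus_eq eq_commute[of 0])
  moreover have "p - q = r - q - (r - p)" for p q r :: complex by simp
  ultimately show ?thesis
    by (simp only: *[of z w] phi_end_eq[OF c assms] of_real_mult)
qed

text \<open>The pairing identity is void at \<open>z = w\<close>, so the value is obtained as a
  limit of difference quotients, by continuity in \<open>z\<close>.\<close>

lemma phi_dual_pairing_diag:
  assumes "a \<le> 2"
  shows "(\<Sum>i=1..n. complex_of_real (g i) * mass_vec \<xi> g w i * dual_vec n \<xi> g a w i) =
    - deriv (phi_end n \<xi> g a) w"
proof -
  let ?S = "\<lambda>z. \<Sum>i=1..n. complex_of_real (g i) * mass_vec \<xi> g z i * dual_vec n \<xi> g a w i"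
  have "isCont ?S w"
    by (intro continuous_intros isCont_mass_vec)
  then have 1: "(?S \<longlongrightarrow> ?S w) (at w)" by (simp add: isCont_def)
  have "(phi_end n \<xi> g a has_field_derivative deriv (phi_end n \<xi> g a) w) (at w)"
    using phi_end_has_derivative[OF c assms, of w] by (simp add: deriv_phi_end[OF c assms])
  then have "((\<lambda>z. (phi_end n \<xi> g a z - phi_end n \<xi> g a w) / (z - w)) \<longlongrightarrow> deriv (phi_end n \<xi> g a) w) (at w)"
    by (simp add: has_field_derivative_iff)
  then have "((\<lambda>z. - ((phi_end n \<xi> g a z - phi_end n \<xi> g a w) / (z - w))) \<longlongrightarrow>
      - deriv (phi_end n \<xi> g a) w) (at w)"
    by (rule tendsto_minus)
  moreover have "\<forall>\<^sub>F z in at w. - ((phi_end n \<xi> g a z - phi_end n \<xi> g a w) / (z - w)) = ?S z"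
  proof -
    have "- ((phi_end n \<xi> g a z - phi_end n \<xi> g a w) / (z - w)) = ?S z" if "z \<noteq> w" for z
      using phi_dual_pairing[OF assms, of z w] that by (simp add: field_simps)
    then show ?thesis by (simp add: eventually_at_filter)
  qed
  ultimately have "(?S \<longlongrightarrow> - deriv (phi_end n \<xi> g a) w) (at w)"
    by (rule Lim_transform_eventually)
  then show ?thesis by (rule LIM_unique[OF 1])
qed

lemma spectrum_elem:
  assumes "a \<le> 2" "z \<in> spectrum n \<xi> g a"
  obtains t where "z = complex_of_real (- t)" "t < 0" "poly (end_char n \<xi> g a) t = 0"
proof -
  have "cpoly (end_char n \<xi> g a) (- z) = 0"
    using assms by (simp add: spectrum_def cpoly_end_char[OF c])
  then obtain t where "- z = complex_of_real t" "t < 0" "poly (end_char n \<xi> g a) t = 0"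
    using end_char_root_real[OF c assms(1)] by blast
  then show ?thesis using that[of t] by (metis minus_minus of_real_minus)
qed

lemma finite_spectrum:
  assumes "a \<le> 2"
  shows "finite (spectrum n \<xi> g a)"
  using card_spectrum[OF c assms] c by (intro card_ge_0_finite) (simp add: cubic_string_def)

lemma deriv_phi_end_nonzero:
  assumes "a \<le> 2" "z \<in> spectrum n \<xi> g a"
  shows "deriv (phi_end n \<xi> g a) z \<noteq> 0"
proof -
  obtain t where t: "z = complex_of_real (- t)" "poly (end_char n \<xi> g a) t = 0"
    using spectrum_elem[OF assms] by blast
  then show ?thesis
    using end_char_simple_root[OF c assms(1) t(2)]
    by (simp add: deriv_phi_end[OF c assms(1)] cpoly_of_real)
qed

text \<open>Biorthogonality says that the matrix of dual vectors is a left inverse of that of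
  normalized \<phi> vectors. As both are square, it is also a right inverse, and that is
  completeness.\<close>

lemma eigenfunction_expansion:
  assumes a: "a \<le> 2" and k: "k \<in> {1..n}"
  shows "f (\<xi> k) = (\<Sum>w\<in>spectrum n \<xi> g a.
    mass_vec \<xi> g w k * fourier n \<xi> g a f w / - deriv (phi_end n \<xi> g a) w)"
proof -
  let ?R = "spectrum n \<xi> g a" and ?d = "\<lambda>w. - deriv (phi_end n \<xi> g a) w"
  obtain e where e: "bij_betw e {0..<n} ?R"
    using ex_bij_betw_nat_finite[OF finite_spectrum[OF a]] card_spectrum[OF c a] by auto
  define X where "X = mat n n (\<lambda>(r, i). complex_of_real (g (Suc i)) * dual_vec n \<xi> g a (e r) (Suc i))"
  define Y where "Y = mat n n (\<lambda>(i, r). mass_vec \<xi> g (e r) (Suc i) / ?d (e r))"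
  have XY: "X * Y = 1\<^sub>m n"
  proof (rule eq_matI)
    fix r s assume "r < dim_row (1\<^sub>m n :: complex mat)" "s < dim_col (1\<^sub>m n :: complex mat)"
    then have rs: "r < n" "s < n" by simp_all
    have R: "e r \<in> ?R" "e s \<in> ?R" using e rs by (auto dest: bij_betwE)
    have "(X * Y) $$ (r, s) = (\<Sum>i\<in>{0..<n}. complex_of_real (g (Suc i)) *
        dual_vec n \<xi> g a (e r) (Suc i) * (mass_vec \<xi> g (e s) (Suc i) / ?d (e s)))"
      using rs by (simp add: X_def Y_def scalar_prod_def)
    also have "\<dots> = (\<Sum>i=1..n. complex_of_real (g i) *
        dual_vec n \<xi> g a (e r) i * (mass_vec \<xi> g (e s) i / ?d (e s)))"
      by (rule sum.reindex_bij_witness[of _ "\<lambda>i. i - 1" Suc]) auto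
    also have "\<dots> = (\<Sum>i=1..n. complex_of_real (g i) * mass_vec \<xi> g (e s) i *
        dual_vec n \<xi> g a (e r) i) / ?d (e s)"
      unfolding sum_divide_distrib by (simp add: mult_ac)
    also have "\<dots> = (if r = s then 1 else 0)"
    proof (cases "r = s")
      case True
      then show ?thesis
        using phi_dual_pairing_diag[OF a, of "e r"] deriv_phi_end_nonzero[OF a R(1)] by simp
    next
      case False
      then have "e r \<noteq> e s" using e rs by (auto simp: bij_betw_def inj_on_def)
      \<comment> \<open>Off the diagonal the boundary values at both spectral points vanish while
        the points differ, so the pairing is 0.\<close>
      then show ?thesis
        using phi_dual_pairing[OF a, of "e s" "e r"] R False by (simp add: spectrum_def)
    qed
    finally show "(X * Y) $$ (r, s) = 1\<^sub>m n $$ (r, s)" using rs by simp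
  qed (simp_all add: X_def Y_def)
  have YX: "Y * X = 1\<^sub>m n"
    by (rule mat_mult_left_right_inverse[OF _ _ XY]) (simp_all add: X_def Y_def)
  have delta: "(\<Sum>w\<in>?R. mass_vec \<xi> g w k / ?d w * (complex_of_real (g l) * dual_vec n \<xi> g a w l)) =
      (if k = l then 1 else 0)" if l: "l \<in> {1..n}" for l
  proof -
    have kl: "k - 1 < n" "l - 1 < n" "Suc (k - 1) = k" "Suc (l - 1) = l" using k l by auto
    have "(\<Sum>w\<in>?R. mass_vec \<xi> g w k / ?d w * (complex_of_real (g l) * dual_vec n \<xi> g a w l)) =
      (\<Sum>r\<in>{0..<n}. mass_vec \<xi> g (e r) k / ?d (e r) * (complex_of_real (g l) * dual_vec n \<xi> g a (e r) l))"
      by (rule sum.reindex_bij_betw[OF e, symmetric])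
    also have "\<dots> = (Y * X) $$ (k - 1, l - 1)"
      using kl by (simp add: X_def Y_def scalar_prod_def)
    also have "\<dots> = (if k = l then 1 else 0)"
      unfolding YX using kl k l by auto
    finally show ?thesis .
  qed
  have "(\<Sum>w\<in>?R. mass_vec \<xi> g w k * fourier n \<xi> g a f w / ?d w) =
      (\<Sum>w\<in>?R. \<Sum>l=1..n. mass_vec \<xi> g w k / ?d w * (complex_of_real (g l) * dual_vec n \<xi> g a w l) * f (\<xi> l))"
    by (simp add: fourier_eq[OF a] sum_distrib_left sum_divide_distrib sum_negf mult_ac)
  also have "\<dots> = (\<Sum>l=1..n. (\<Sum>w\<in>?R. mass_vec \<xi> g w k / ?d w *
      (complex_of_real (g l) * dual_vec n \<xi> g a w l)) * f (\<xi> l))"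
    by (subst sum.swap) (simp only: sum_distrib_right)
  also have "\<dots> = (\<Sum>l=1..n. (if k = l then 1 else 0) * f (\<xi> l))"
    by (rule sum.cong) (simp_all only: delta)
  also have "\<dots> = f (\<xi> k)"
    using k by (simp add: if_distrib[of "\<lambda>x. x * _"] cong: if_cong)
  finally show ?thesis ..
qed

text \<open>With \<open>e i = 1 - \<xi> i\<close> the single sums in \<open>concomitant_self\<close>
  are those of the boundary values at 1.\<close>

lemma phi_phi_pairing:
  "(x + y) * (\<Sum>i=1..n. complex_of_real (g i) * mass_vec \<xi> g x i * mass_vec \<xi> g y i) =
    phi_end n \<xi> g 1 x * phi_end n \<xi> g 1 y - phi_end n \<xi> g 2 x * phi_end n \<xi> g 0 y
    - phi_end n \<xi> g 0 x * phi_end n \<xi> g 2 y"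
proof -
  \<comment> \<open>At most one of the two summands is nonzero, and on the diagonal both sides are
    0.\<close>
  have "causal_kernel \<xi> i j + causal_kernel \<xi> j i =
      ((1 - complex_of_real (\<xi> i)) - (1 - complex_of_real (\<xi> j)))\<^sup>2 / 2" for i j
    by (cases i j rule: linorder_cases) (auto simp: causal_kernel_def power2_commute)
  note conc = concomitant_self[where I="{1..n}" and K="causal_kernel \<xi>" and e="\<lambda>i. 1 - complex_of_real (\<xi> i)"
      and f="mass_vec \<xi> g x" and h="mass_vec \<xi> g y", OF mass_vec_causal_kernel mass_vec_causal_kernel this]
  show ?thesis
    using conc by (simp add: phi_end_eq[OF c] end_kernel_def)
qed

section \<open>Weights for the four type pairs\<close>

context
  fixes a b :: nat
  assumes ab: "(a, b) \<in> {(0, 0), (0, 1), (1, 2), (2, 2)}"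
begin

lemma type_le: "a \<le> 2" "b \<le> 2"
  using ab by auto

text \<open>The minus sign is the chain rule for \<open>x = - z\<close>.\<close>

lemma weight_quotient:
  assumes "z = complex_of_real (- t)"
  shows "k \<le> 2 \<Longrightarrow> l \<le> 2 \<Longrightarrow> phi_end n \<xi> g k z / deriv (phi_end n \<xi> g l) z =
    complex_of_real (- (poly (end_char n \<xi> g k) t / poly (pderiv (end_char n \<xi> g l)) t))"
  using cpoly_end_char[OF c, of k "complex_of_real t"] assms
  by (simp add: deriv_phi_end[OF c] cpoly_of_real)

text \<open>In \<open>discrete_measure\<close>, \<open>Re\<close> drops an imaginary part and
  \<open>ennreal\<close> sends negative numbers to 0; this lemma ensures that neither changes the
  weight.\<close>

lemma weight_A_nonneg:
  assumes "z \<in> spectrum n \<xi> g a"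
  obtains r where "0 \<le> r" "weight_A n \<xi> g a b z = complex_of_real r"
proof -
  obtain t where t: "z = complex_of_real (- t)" "poly (end_char n \<xi> g a) t = 0"
    using spectrum_elem[OF type_le(1) assms] .
  note q = weight_quotient[OF t(1)]
  have "\<exists>r\<ge>0. weight_A n \<xi> g a b z = complex_of_real r"
    using ab t(2) q[of 1 0] q[of 2 0] q[of 2 1] q[of 1 2] end_char_quotient_signs[OF c, of t]
    by (auto simp: weight_A_def simp flip: of_real_minus)
  then show ?thesis using that by blast
qed

lemma weight_B_nonneg:
  assumes "z \<in> spectrum n \<xi> g b"
  obtains r where "0 \<le> r" "weight_B n \<xi> g a b z = complex_of_real r"
proof -
  obtain t where t: "z = complex_of_real (- t)" "poly (end_char n \<xi> g b) t = 0"
    using spectrum_elem[OF type_le(2) assms] .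
  note q = weight_quotient[OF t(1)]
  have "\<exists>r\<ge>0. weight_B n \<xi> g a b z = complex_of_real r"
    using ab t(2) q[of 1 0] q[of 0 1] q[of 0 2] q[of 1 2] end_char_quotient_signs[OF c, of t]
    by (auto simp: weight_B_def simp flip: of_real_minus)
  then show ?thesis using that by blast
qed

text \<open>As type \<open>a\<close> vanishes at \<open>x\<close> and type \<open>b\<close> at
  \<open>y\<close>, a single boundary product survives in \<open>phi_phi_pairing\<close>: the one
  with first derivatives for equal types, otherwise minus the second derivative at \<open>x\<close>
  times the value at \<open>y\<close>.\<close>

lemma weights_pairing:
  assumes x: "x \<in> spectrum n \<xi> g a" and y: "y \<in> spectrum n \<xi> g b"
  shows "(\<Sum>i=1..n. complex_of_real (g i) * mass_vec \<xi> g x i * mass_vec \<xi> g y i) /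
      (deriv (phi_end n \<xi> g a) x * deriv (phi_end n \<xi> g b) y) =
    weight_A n \<xi> g a b x * weight_B n \<xi> g a b y / (x + y)"
proof -
  obtain s where s: "x = complex_of_real (- s)" "s < 0" using spectrum_elem[OF type_le(1) x] .
  obtain t where t: "y = complex_of_real (- t)" "t < 0" using spectrum_elem[OF type_le(2) y] .
  have "x + y = complex_of_real (- s - t)" using s t by simp
  moreover have "- s - t \<noteq> 0" using s(2) t(2) by linarith
  ultimately have "x + y \<noteq> 0" by (simp only: of_real_eq_0_iff) simp
  then have S: "(\<Sum>i=1..n. complex_of_real (g i) * mass_vec \<xi> g x i * mass_vec \<xi> g y i) =
    (phi_end n \<xi> g 1 x * phi_end n \<xi> g 1 y - phi_end n \<xi> g 2 x * phi_end n \<xi> g 0 y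
    - phi_end n \<xi> g 0 x * phi_end n \<xi> g 2 y) / (x + y)"
    using phi_phi_pairing[of x y] by (simp add: field_simps)
  have "phi_end n \<xi> g a x = 0" "phi_end n \<xi> g b y = 0"
    using x y by (simp_all add: spectrum_def)
  then show ?thesis
    unfolding S using ab by (auto simp: weight_A_def weight_B_def mult_ac)
qed

lemma parseval_sum:
  "inner_g n \<xi> g f h = (\<Sum>x\<in>spectrum n \<xi> g a. \<Sum>y\<in>spectrum n \<xi> g b.
     weight_A n \<xi> g a b x * weight_B n \<xi> g a b y *
       (fourier n \<xi> g a f x * fourier n \<xi> g b h y / (x + y)))"
proof -
  let ?dx = "deriv (phi_end n \<xi> g a)" and ?dy = "deriv (phi_end n \<xi> g b)"
  let ?X = "spectrum n \<xi> g a" and ?Y = "spectrum n \<xi> g b"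
  have "inner_g n \<xi> g f h = (\<Sum>i=1..n. \<Sum>x\<in>?X. \<Sum>y\<in>?Y. complex_of_real (g i) *
      (mass_vec \<xi> g x i * fourier n \<xi> g a f x / - ?dx x) *
      (mass_vec \<xi> g y i * fourier n \<xi> g b h y / - ?dy y))"
    unfolding inner_g_def
  proof (rule sum.cong)
    fix i assume i: "i \<in> {1..n}"
    show "complex_of_real (g i) * f (\<xi> i) * h (\<xi> i) = (\<Sum>x\<in>?X. \<Sum>y\<in>?Y. complex_of_real (g i) *
      (mass_vec \<xi> g x i * fourier n \<xi> g a f x / - ?dx x) *
      (mass_vec \<xi> g y i * fourier n \<xi> g b h y / - ?dy y))"
      unfolding eigenfunction_expansion[OF type_le(1) i, of f] eigenfunction_expansion[OF type_le(2) i, of h]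
      by (simp only: sum_distrib_left sum_distrib_right mult.assoc) (rule sum.swap)
  qed simp
  also have "\<dots> = (\<Sum>x\<in>?X. \<Sum>i=1..n. \<Sum>y\<in>?Y. complex_of_real (g i) *
      (mass_vec \<xi> g x i * fourier n \<xi> g a f x / - ?dx x) *
      (mass_vec \<xi> g y i * fourier n \<xi> g b h y / - ?dy y))"
    by (rule sum.swap)
  also have "\<dots> = (\<Sum>x\<in>?X. \<Sum>y\<in>?Y. \<Sum>i=1..n. complex_of_real (g i) *
      (mass_vec \<xi> g x i * fourier n \<xi> g a f x / - ?dx x) *
      (mass_vec \<xi> g y i * fourier n \<xi> g b h y / - ?dy y))"
    by (intro sum.cong refl) (rule sum.swap)
  \<comment> \<open>The minus signs of the two normalizations cancel.\<close>
  also have "\<dots> = (\<Sum>x\<in>?X. \<Sum>y\<in>?Y. fourier n \<xi> g a f x * fourier n \<xi> g b h y *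
      ((\<Sum>i=1..n. complex_of_real (g i) * mass_vec \<xi> g x i * mass_vec \<xi> g y i) / (?dx x * ?dy y)))"
    by (intro sum.cong refl) (simp add: sum_distrib_left sum_divide_distrib mult_ac)
  also have "\<dots> = (\<Sum>x\<in>?X. \<Sum>y\<in>?Y. weight_A n \<xi> g a b x * weight_B n \<xi> g a b y *
       (fourier n \<xi> g a f x * fourier n \<xi> g b h y / (x + y)))"
    by (intro sum.cong refl, subst weights_pairing) (simp_all add: mult_ac)
  finally show ?thesis .
qed

end

end

section \<open>Integrals against the spectral measures\<close>

lemma integral_discrete_measure:
  fixes F :: "real \<Rightarrow> complex"
  assumes S: "finite S" "S \<subseteq> \<real>" and w: "\<And>z. z \<in> S \<Longrightarrow> \<exists>r\<ge>0. w z = complex_of_real r"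
    and F: "F \<in> borel_measurable borel"
  shows "(LINT x|discrete_measure S w. F x) = (\<Sum>z\<in>S. w z * F (Re z))"
proof -
  have S': "{x. complex_of_real x \<in> S} = Re ` S"
    using S(2) by (force simp: Reals_def)
  have "(LINT x|discrete_measure S w. F x) =
      (LINT x|point_measure (Re ` S) (\<lambda>x. ennreal (Re (w (complex_of_real x)))). F x)"
    unfolding discrete_measure_def S'
    by (rule integral_distr[OF _ F]) simp
  also have "\<dots> = (\<Sum>x\<in>Re ` S. Re (w (complex_of_real x)) *\<^sub>R F x)"
  proof (rule lebesgue_integral_point_measure_finite)
    fix x assume "x \<in> Re ` S"
    then have "complex_of_real x \<in> S" using S' by blast
    then show "0 \<le> Re (w (complex_of_real x))" using w by fastforce
  qed (use S(1) in simp)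
  also have "\<dots> = (\<Sum>z\<in>S. Re (w (complex_of_real (Re z))) *\<^sub>R F (Re z))"
  proof (rule sum.reindex_cong[of Re])
    show "inj_on Re S" using S(2) by (metis inj_onI of_real_Re subset_iff)
  qed simp_all
  also have "\<dots> = (\<Sum>z\<in>S. w z * F (Re z))"
  proof (rule sum.cong)
    fix z assume z: "z \<in> S"
    then have "complex_of_real (Re z) = z" using S(2) by (metis of_real_Re subset_iff)
    moreover have "complex_of_real (Re (w z)) = w z" using w[OF z] by auto
    ultimately show "Re (w (complex_of_real (Re z))) *\<^sub>R F (Re z) = w z * F (Re z)"
      by (simp add: scaleR_conv_of_real)
  qed simp
  finally show ?thesis .
qed

lemma cauchy_pairing_eq_sum:
  assumes c: "cubic_string n \<xi> g" and ab: "(a, b) \<in> {(0, 0), (0, 1), (1, 2), (2, 2)}"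
  shows "cauchy_pairing (spectral_alpha n \<xi> g a b) (spectral_beta n \<xi> g a b)
      (fourier n \<xi> g a f) (fourier n \<xi> g b h) =
    (\<Sum>x\<in>spectrum n \<xi> g a. \<Sum>y\<in>spectrum n \<xi> g b.
     weight_A n \<xi> g a b x * weight_B n \<xi> g a b y *
       (fourier n \<xi> g a f x * fourier n \<xi> g b h y / (x + y)))"
proof -
  let ?X = "spectrum n \<xi> g a" and ?Y = "spectrum n \<xi> g b"
  let ?p = "fourier n \<xi> g a f" and ?q = "fourier n \<xi> g b h"
  note le = type_le[OF c ab]
  have real: "complex_of_real (Re z) = z" if "k \<le> 2" "z \<in> spectrum n \<xi> g k" for k z
    using spectrum_elem[OF c that] by (metis Re_complex_of_real)
  have X: "finite ?X" "?X \<subseteq> \<real>" and Y: "finite ?Y" "?Y \<subseteq> \<real>"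
    using finite_spectrum[OF c] le real by (auto simp: subset_iff complex_is_Real_iff) (metis Im_complex_of_real)+
  have wA: "\<And>z. z \<in> ?X \<Longrightarrow> \<exists>r\<ge>0. weight_A n \<xi> g a b z = complex_of_real r"
    using weight_A_nonneg[OF c ab] by metis
  have wB: "\<And>z. z \<in> ?Y \<Longrightarrow> \<exists>r\<ge>0. weight_B n \<xi> g a b z = complex_of_real r"
    using weight_B_nonneg[OF c ab] by metis
  have [measurable]: "(\<lambda>x. ?p (complex_of_real x)) \<in> borel_measurable borel"
    "(\<lambda>x. ?q (complex_of_real x)) \<in> borel_measurable borel"
    using fourier_continuous[OF c] le by (auto intro: borel_measurable_continuous_onI)
  \<comment> \<open>Stated for every real \<open>x\<close>, also where a denominator vanishes:
    division by zero is 0 on both sides. This permits rewriting under the outer integral.\<close>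
  have inner: "(LINT y|spectral_beta n \<xi> g a b.
        ?p (complex_of_real x) * ?q (complex_of_real y) / complex_of_real (x + y)) =
      (\<Sum>y\<in>?Y. weight_B n \<xi> g a b y * (?p (complex_of_real x) * ?q (complex_of_real (Re y)) /
        complex_of_real (x + Re y)))" for x
    unfolding spectral_beta_def by (rule integral_discrete_measure[OF Y wB]) simp_all
  have "cauchy_pairing (spectral_alpha n \<xi> g a b) (spectral_beta n \<xi> g a b) ?p ?q =
     (\<Sum>x\<in>?X. weight_A n \<xi> g a b x * (\<Sum>y\<in>?Y. weight_B n \<xi> g a b y *
       (?p (complex_of_real (Re x)) * ?q (complex_of_real (Re y)) / complex_of_real (Re x + Re y))))"
    unfolding cauchy_pairing_def inner
    unfolding spectral_alpha_def by (rule integral_discrete_measure[OF X wA]) simp_all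
  also have "\<dots> = (\<Sum>x\<in>?X. \<Sum>y\<in>?Y. weight_A n \<xi> g a b x * weight_B n \<xi> g a b y *
       (?p x * ?q y / (x + y)))"
    unfolding sum_distrib_left by (intro sum.cong refl) (simp add: real[OF le(1)] real[OF le(2)] mult_ac)
  finally show ?thesis .
qed

theorem theorem3p1:
  fixes n a b :: nat and \<xi> g :: "nat \<Rightarrow> real" and f h :: "real \<Rightarrow> complex"
  assumes "cubic_string n \<xi> g"
    and "(a, b) \<in> {(0, 0), (0, 1), (1, 2), (2, 2)}"
  shows "inner_g n \<xi> g f h =
           cauchy_pairing (spectral_alpha n \<xi> g a b) (spectral_beta n \<xi> g a b)
             (fourier n \<xi> g a f) (fourier n \<xi> g b h) \<and>
         inner_g n \<xi> g f h =
           cauchy_pairing (spectral_alpha n \<xi> g a b) (spectral_beta n \<xi> g a b)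
             (fourier n \<xi> g a h) (fourier n \<xi> g b f)"
proof -
  \<comment> \<open>By symmetry of the bilinear form, the second equality is the first with
    \<open>f\<close> and \<open>h\<close> exchanged.\<close>
  have "inner_g n \<xi> g f h = inner_g n \<xi> g h f"
    by (simp add: inner_g_def mult_ac)
  then show ?thesis
    using parseval_sum[OF assms] cauchy_pairing_eq_sum[OF assms] by metis
qed

end
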